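(* Let $F=(f_1,\ldots,f_n)^T$ be a polynomial system with $f_i\in\mathbb{K}[x_1,\ldots,x_n]$, let $\mu\ge 2$ be an integer, and let $G(\mathbf{x},\mathbf{b},\mathbf{a})$ be the deflated system of $\mu n$ equations in $\mu n$ variables associated with $F$ and $\mu$ (defined in the context). Suppose $G(\hat{\mathbf{x}},\hat{\mathbf{b}},\hat{\mathbf{a}})=0$. Assume that $J_F(\hat{\mathbf{x}})$ has corank one, that the first row of $J_F(\hat{\mathbf{x}})$ is a linear combination of its other rows, and that the first column of $J_F(\hat{\mathbf{x}})$ is a linear combination of its other columns. If the Jacobian matrix $J_G(\hat{\mathbf{x}},\hat{\mathbf{b}},\hat{\mathbf{a}})$ is nonsingular, then $\hat{\mathbf{x}}$ is an isolated root of the polynomial system $F_0(\mathbf{x})=F_1(\mathbf{x},\hat{\mathbf{b}})$ with multiplicity $\mu$, and the corank of $J_{F_0}(\hat{\mathbf{x}})$ is one.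
   Context: $\mathbb{K}$ is a field of characteristic zero and $\mathbf{x}=(x_1,\ldots,x_n)$. The corank of an $n\times n$ matrix is $n$ minus its rank. The multiplicity of an isolated root $\hat{\mathbf{x}}\in\mathbb{K}^n$ of a system $F=\{f_1,\ldots,f_n\}$ is $\dim_{\mathbb{K}}\mathbb{K}[\mathbf{x}]/Q_{\hat{\mathbf{x}}}$, where $Q_{\hat{\mathbf{x}}}$ is the isolated primary component of the ideal $(f_1,\ldots,f_n)$ whose associated prime is $(x_1-\hat{x}_1,\ldots,x_n-\hat{x}_n)$. Deflated system. Introduce smoothing parameters $\mathbf{b}=[b_0,b_1,\ldots,b_{\mu-2}]$ and parameters $\mathbf{a}=[\mathbf{a}_2,\ldots,\mathbf{a}_\mu]$ with $\mathbf{a}_2=[1,a_{2,2},\ldots,a_{2,n}]^T$ and $\mathbf{a}_k=[0,a_{k,2},\ldots,a_{k,n}]^T$ for $2<k\le\mu$; the unknowns are the $a_{k,j}$, $2\le k\le\mu$, $2\le j\le n$. Let $\mathbf{e}_1=(1,0,\ldots,0)^T\in\mathbb{K}^n$ and $$F_1(\mathbf{x},\mathbf{b})=F(\mathbf{x})-\left(\sum_{\nu=0}^{\mu-2}\frac{b_\nu x_1^\nu}{\nu!}\right)\mathbf{e}_1 .$$ For a system $H$ of $n$ polynomials let $J_H$ denote its $n\times n$ Jacobian matrix with respect to $\mathbf{x}$ (all $a_{k,j}$ and $b_\nu$ treated as constants), and define recursively $L_2(H)=J_H\cdot\mathbf{a}_2$ and, for $k\ge 3$, $$P_k(H)=\sum_{j=1}^{k-2}\frac{j}{k-1}\,J_{L_{k-j}(H)}\cdot\mathbf{a}_{j+1},\qquad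 L_k(H)=P_k(H)+J_H\cdot\mathbf{a}_k .$$ Put $F_k(\mathbf{x},\mathbf{b},\mathbf{a}_2,\ldots,\mathbf{a}_k)=L_k(F_1)$ for $2\le k\le\mu$, and $$G(\mathbf{x},\mathbf{b},\mathbf{a})=\begin{pmatrix}F_1(\mathbf{x},\mathbf{b})\\ F_2(\mathbf{x},\mathbf{b},\mathbf{a}_2)\\ \vdots\\ F_\mu(\mathbf{x},\mathbf{b},\mathbf{a}_2,\ldots,\mathbf{a}_\mu)\end{pmatrix}.$$ $J_G$ denotes the $\mu n\times\mu n$ Jacobian matrix of $G$ with respect to all variables $(\mathbf{x},\mathbf{b},\mathbf{a})$ (that is, $x_1,\ldots,x_n$, $b_0,\ldots,b_{\mu-2}$, and the $a_{k,j}$). *)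

theory Defs
  imports
    "HOL-Library.Poly_Mapping"
    "HOL-Algebra.QuotRing"
    "HOL-Algebra.Embedded_Algebras"
    "Jordan_Normal_Form.DL_Rank"
begin

section \<open>Polynomials\<close>

text \<open>One polynomial type serves for all systems: \<open>Xv i\<close> is \<open>x\<^sub>i\<close>, \<open>Bv \<nu>\<close> is \<open>b\<^sub>\<nu>\<close> and
  \<open>Av k j\<close> is \<open>a\<^bsub>k,j\<^esub>\<close>, with the indices of the mathematical text
  (\<open>i\<close>, \<open>j\<close> and \<open>k\<close> start at 1, \<open>\<nu>\<close> starts at 0).\<close>

datatype var = Xv nat | Bv nat | Av nat nat

type_synonym 'a mpoly = "(var \<Rightarrow>\<^sub>0 nat) \<Rightarrow>\<^sub>0 'a"

definition const_mp :: "'a::zero \<Rightarrow> 'a mpoly" where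
  "const_mp c = Poly_Mapping.single 0 c"

definition var_mp :: "var \<Rightarrow> 'a::zero_neq_one mpoly" where
  "var_mp v = Poly_Mapping.single (Poly_Mapping.single v 1) 1"

definition vars_mp :: "'a::zero mpoly \<Rightarrow> var set" where
  "vars_mp p = (\<Union>m\<in>Poly_Mapping.keys p. Poly_Mapping.keys m)"

text \<open>Substitution of \<open>s v\<close> for each variable \<open>v\<close>, with \<open>h\<close> embedding the coefficients
  into the target ring.\<close>

definition insertion_mp ::
    "('a::zero \<Rightarrow> 'b::comm_semiring_1) \<Rightarrow> (var \<Rightarrow> 'b) \<Rightarrow> 'a mpoly \<Rightarrow> 'b" where
  "insertion_mp h s p =
     (\<Sum>m\<in>Poly_Mapping.keys p. h (Poly_Mapping.lookup p m) *
        (\<Prod>v\<in>Poly_Mapping.keys m. s v ^ Poly_Mapping.lookup m v))"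

abbreviation eval_mp :: "(var \<Rightarrow> 'a::comm_semiring_1) \<Rightarrow> 'a mpoly \<Rightarrow> 'a" where
  "eval_mp \<equiv> insertion_mp (\<lambda>c. c)"

abbreviation subst_mp :: "(var \<Rightarrow> 'a::comm_semiring_1 mpoly) \<Rightarrow> 'a mpoly \<Rightarrow> 'a mpoly" where
  "subst_mp \<equiv> insertion_mp const_mp"

text \<open>Formal partial derivative; when \<open>v\<close> does not occur in \<open>m\<close>, the truncated subtraction
  of exponents is harmless because the coefficient is 0.\<close>

definition pdiff :: "var \<Rightarrow> 'a::comm_semiring_1 mpoly \<Rightarrow> 'a mpoly" where
  "pdiff v p =
     (\<Sum>m\<in>Poly_Mapping.keys p.
        Poly_Mapping.single (m - Poly_Mapping.single v 1)
          (of_nat (Poly_Mapping.lookup m v) * Poly_Mapping.lookup p m))"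

definition xvars :: "nat \<Rightarrow> var list" where
  "xvars n = map Xv [1..<Suc n]"

definition jacobian :: "var list \<Rightarrow> 'a::comm_semiring_1 mpoly vec \<Rightarrow> 'a mpoly mat" where
  "jacobian vs H = mat (dim_vec H) (length vs) (\<lambda>(i, j). pdiff (vs ! j) (H $ i))"

definition jacobian_at ::
    "(var \<Rightarrow> 'a::comm_semiring_1) \<Rightarrow> var list \<Rightarrow> 'a mpoly vec \<Rightarrow> 'a mat" where
  "jacobian_at pt vs H = map_mat (eval_mp pt) (jacobian vs H)"

definition poly_ring :: "nat \<Rightarrow> 'a::comm_ring_1 mpoly ring" where
  "poly_ring n = \<lparr>carrier = {p. vars_mp p \<subseteq> set (xvars n)},
                  mult = (*), one = 1, zero = 0, add = (+)\<rparr>"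

text \<open>For systems in \<open>K[x]\<close> the values chosen for the other variables are irrelevant.\<close>

definition x_point :: "(nat \<Rightarrow> 'a::zero) \<Rightarrow> var \<Rightarrow> 'a" where
  "x_point x v = (case v of Xv i \<Rightarrow> x i | _ \<Rightarrow> 0)"

definition first_row_dependent :: "'a::comm_ring_1 mat \<Rightarrow> bool" where
  "first_row_dependent M \<longleftrightarrow>
     (\<exists>c. row M 0 = vec (dim_col M) (\<lambda>j. \<Sum>i=1..<dim_row M. c i * M $$ (i, j)))"

definition first_col_dependent :: "'a::comm_ring_1 mat \<Rightarrow> bool" where
  "first_col_dependent M \<longleftrightarrow>
     (\<exists>c. col M 0 = vec (dim_row M) (\<lambda>i. \<Sum>j=1..<dim_col M. c j * M $$ (i, j)))"

definition corank :: "nat \<Rightarrow> 'a::field mat \<Rightarrow> nat" where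
  "corank n M = n - vec_space.rank n M"


section \<open>Isolated roots and their multiplicity\<close>

definition radical :: "('a, 'b) ring_scheme \<Rightarrow> 'a set \<Rightarrow> 'a set" where
  "radical R I = {a \<in> carrier R. \<exists>k::nat. a [^]\<^bsub>R\<^esub> k \<in> I}"

definition primary_ideal :: "('a, 'b) ring_scheme \<Rightarrow> 'a set \<Rightarrow> bool" where
  "primary_ideal R Q \<longleftrightarrow> ideal Q R \<and> Q \<noteq> carrier R \<and>
     (\<forall>a\<in>carrier R. \<forall>b\<in>carrier R. a \<otimes>\<^bsub>R\<^esub> b \<in> Q \<longrightarrow> a \<in> Q \<or> b \<in> radical R Q)"

definition minimal_primary_decomposition ::
    "('a, 'b) ring_scheme \<Rightarrow> 'a set \<Rightarrow> 'a set set \<Rightarrow> bool" where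
  "minimal_primary_decomposition R I D \<longleftrightarrow>
     finite D \<and> (\<forall>Q\<in>D. primary_ideal R Q) \<and> I = carrier R \<inter> \<Inter>D \<and>
     inj_on (radical R) D \<and> (\<forall>Q\<in>D. \<not> carrier R \<inter> \<Inter>(D - {Q}) \<subseteq> Q)"

text \<open>\<open>Q\<close> is the isolated primary component of \<open>I\<close> with associated prime \<open>P\<close>: a component of a
  minimal primary decomposition whose radical \<open>P\<close> is minimal among the associated primes.
  By the second uniqueness theorem for primary decompositions \<open>Q\<close> depends only on \<open>I\<close>
  and \<open>P\<close>.\<close>

definition isolated_primary_component ::
    "('a, 'b) ring_scheme \<Rightarrow> 'a set \<Rightarrow> 'a set \<Rightarrow> 'a set \<Rightarrow> bool" where
  "isolated_primary_component R I P Q \<longleftrightarrow>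
     (\<exists>D. minimal_primary_decomposition R I D \<and> Q \<in> D \<and> radical R Q = P \<and>
          (\<forall>Q'\<in>D. radical R Q' \<subseteq> P \<longrightarrow> radical R Q' = P))"

definition system_ideal :: "nat \<Rightarrow> 'a::comm_ring_1 mpoly vec \<Rightarrow> 'a mpoly set" where
  "system_ideal n F = Idl\<^bsub>poly_ring n\<^esub> (set\<^sub>v F)"

definition point_ideal :: "nat \<Rightarrow> (nat \<Rightarrow> 'a::comm_ring_1) \<Rightarrow> 'a mpoly set" where
  "point_ideal n x = Idl\<^bsub>poly_ring n\<^esub> {var_mp (Xv i) - const_mp (x i) | i. i \<in> {1..n}}"

definition isolated_root :: "nat \<Rightarrow> 'a::comm_ring_1 mpoly vec \<Rightarrow> (nat \<Rightarrow> 'a) \<Rightarrow> bool" where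
  "isolated_root n F x \<longleftrightarrow>
     (\<forall>p\<in>set\<^sub>v F. eval_mp (x_point x) p = 0) \<and>
     (\<exists>Q. isolated_primary_component (poly_ring n) (system_ideal n F) (point_ideal n x) Q)"

text \<open>The dimension of the quotient is taken over the image of the ground field in it.\<close>

definition has_multiplicity ::
    "nat \<Rightarrow> 'a::comm_ring_1 mpoly vec \<Rightarrow> (nat \<Rightarrow> 'a) \<Rightarrow> nat \<Rightarrow> bool" where
  "has_multiplicity n F x d \<longleftrightarrow>
     (\<exists>Q. isolated_primary_component (poly_ring n) (system_ideal n F) (point_ideal n x) Q \<and>
          ring.dimension (poly_ring n Quot Q) d
            (range (\<lambda>c. Q +>\<^bsub>poly_ring n\<^esub> const_mp c))
            (carrier (poly_ring n Quot Q)))"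


section \<open>The deflated system\<close>

text \<open>Entries of vectors and matrices are indexed from 0, so entry \<open>i\<close> of \<open>F\<close> is
  the polynomial \<open>f\<^bsub>i+1\<^esub>\<close>.\<close>

definition a_vec :: "nat \<Rightarrow> nat \<Rightarrow> 'a::comm_ring_1 mpoly vec" where
  "a_vec n k = vec n (\<lambda>i. if i = 0 then (if k = 2 then 1 else 0) else var_mp (Av k (Suc i)))"

definition F1 :: "nat \<Rightarrow> nat \<Rightarrow> 'a::field_char_0 mpoly vec \<Rightarrow> 'a mpoly vec" where
  "F1 n \<mu> F = F - (\<Sum>\<nu>=0..\<mu> - 2. const_mp (1 / fact \<nu>) * var_mp (Bv \<nu>) * var_mp (Xv 1) ^ \<nu>)
                    \<cdot>\<^sub>v unit_vec n 0"

text \<open>Only the values for \<open>k \<ge> 2\<close> are meaningful.\<close>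

function L :: "nat \<Rightarrow> 'a::field_char_0 mpoly vec \<Rightarrow> nat \<Rightarrow> 'a mpoly vec" where
  "L n H k =
     (if k < 2 then 0\<^sub>v n
      else if k = 2 then jacobian (xvars n) H *\<^sub>v a_vec n 2
      else vec n (\<lambda>i. \<Sum>j=1..k - 2. const_mp (of_nat j / of_nat (k - 1)) *
                        (jacobian (xvars n) (L n H (k - j)) *\<^sub>v a_vec n (j + 1)) $ i)
           + jacobian (xvars n) H *\<^sub>v a_vec n k)"
  by pat_completeness auto
termination
  by (relation "measure (\<lambda>(n, H, k). k)") auto

declare L.simps [simp del]

text \<open>The blocks \<open>F\<^sub>1, \<dots>, F\<^sub>\<mu>\<close> of length \<open>n\<close>, stacked.\<close>

definition G :: "nat \<Rightarrow> nat \<Rightarrow> 'a::field_char_0 mpoly vec \<Rightarrow> 'a mpoly vec" where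
  "G n \<mu> F = vec (\<mu> * n) (\<lambda>r.
     (if r div n = 0 then F1 n \<mu> F else L n (F1 n \<mu> F) (r div n + 1)) $ (r mod n))"

definition all_vars :: "nat \<Rightarrow> nat \<Rightarrow> var list" where
  "all_vars n \<mu> = xvars n @ map Bv [0..<\<mu> - 1] @
     [Av k j. k \<leftarrow> [2..<Suc \<mu>], j \<leftarrow> [2..<Suc n]]"

definition full_point ::
    "(nat \<Rightarrow> 'a) \<Rightarrow> (nat \<Rightarrow> 'a) \<Rightarrow> (nat \<Rightarrow> nat \<Rightarrow> 'a) \<Rightarrow> var \<Rightarrow> 'a" where
  "full_point x b a v = (case v of Xv i \<Rightarrow> x i | Bv \<nu> \<Rightarrow> b \<nu> | Av k j \<Rightarrow> a k j)"

text \<open>\<open>F\<^sub>0(x) = F\<^sub>1(x, b)\<close> for constants \<open>b\<close>.\<close>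

definition F0 ::
    "nat \<Rightarrow> nat \<Rightarrow> 'a::field_char_0 mpoly vec \<Rightarrow> (nat \<Rightarrow> 'a) \<Rightarrow> 'a mpoly vec" where
  "F0 n \<mu> F b =
     map_vec (subst_mp (\<lambda>v. case v of Bv \<nu> \<Rightarrow> const_mp (b \<nu>) | _ \<Rightarrow> var_mp v)) (F1 n \<mu> F)"

end

theory Submission
  imports Defs "HOL-Algebra.Ring_Divisibility"
begin

text \<open>Write the given zero of the deflated system as an arc
  \<open>X(t) = x + a\<^sub>2 t + \<dots> + a\<^sub>\<mu> t\<^bsup>\<mu>-1\<^esup>\<close>; its first coordinate is \<open>x\<^sub>1 + t\<close>. The recursion for
  \<open>L\<close> is the chain rule, read coefficient by coefficient: \<open>F\<^sub>k\<close> is the coefficient of \<open>t\<^bsup>k-1\<^esup>\<close> in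
  \<open>F\<^sub>1(X(t), b)\<close> (lemma \<open>L_eq_arc_coeff\<close>). Hence the equations \<open>G = 0\<close> say that \<open>F\<^sub>0\<close> vanishes to
  order \<open>\<mu>\<close> along the arc, that is, the ideal \<open>I\<close> of \<open>F\<^sub>0\<close> is contained in
  \<open>Q = {p. p(X(t)) \<equiv> 0 mod t\<^sup>\<mu>}\<close>. This \<open>Q\<close> is primary for the maximal ideal of the point, and
  its residue ring \<open>K[t]/(t\<^sup>\<mu>)\<close> has dimension \<open>\<mu>\<close>.

  It remains to see that \<open>I\<close> and \<open>Q\<close> agree near the point. The ideal \<open>Q\<close> is generated by \<open>t\<^sup>\<mu>\<close>
  and the \<open>n - 1\<close> polynomials \<open>x\<^sub>j - X\<^sub>j(t)\<close>, where \<open>t\<close> stands for \<open>x\<^sub>1\<close> minus its value at the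
  point. So \<open>F\<^sub>0\<close> is the product of an \<open>n \<times> n\<close> matrix \<open>N\<close> with these generators, and the value of
  \<open>N\<close> at the point consists of the coefficient vector of \<open>t\<^sup>\<mu>\<close> in \<open>F\<^sub>0(X(t))\<close> and the columns
  \<open>2, \<dots>, n\<close> of the Jacobian matrix. If this value is nonsingular, then \<open>g = det N\<close> does not vanish
  at the point and \<open>g Q \<subseteq> I\<close> by the adjugate matrix (lemma \<open>contact_ideal_isolated\<close>). Such a \<open>g\<close>
  makes \<open>Q\<close> the isolated primary component of \<open>I\<close> at the point
  (lemma \<open>isolated_primary_componentI\<close>); the primary decomposition of \<open>I\<close> itself comes from
  Hilbert's basis theorem and noetherian induction.

  Finally, a vector \<open>v\<close> in the kernel of \<open>N\<close> at the point yields the deformation of the arc in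
  the direction \<open>v\<^sub>1 X'(t) + \<mu> t\<^bsup>\<mu>-1\<^esup> (0, v\<^sub>2, \<dots>, v\<^sub>n)\<close> with \<open>b\<close> kept fixed. It is tangent to
  \<open>G = 0\<close>: the derivative of \<open>F\<^sub>0(X(t))\<close> in this direction is \<open>v\<^sub>1 (F\<^sub>0(X(t)))'\<close> plus \<open>\<mu> t\<^bsup>\<mu>-1\<^esup>\<close>
  times a combination of the columns \<open>2, \<dots>, n\<close> of the Jacobian matrix, and modulo \<open>t\<^sup>\<mu>\<close> only
  the coefficient \<open>\<mu> N v = 0\<close> of \<open>t\<^bsup>\<mu>-1\<^esup>\<close> is left. Since \<open>J\<^sub>G\<close> is nonsingular, the deformation and
  hence \<open>v\<close> vanish (lemma \<open>det_contact_mat\<close>). The same matrix gives the corank: \<open>a\<^sub>2\<close> is in the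
  kernel of the Jacobian matrix of \<open>F\<^sub>0\<close>, and the columns \<open>2, \<dots>, n\<close> are independent because they
  are columns of \<open>N\<close> at the point.\<close>

section \<open>Primary decomposition in noetherian rings\<close>

lemma (in cring) noetherian_maximal_ideal:
  assumes "noetherian_ring R" and S: "S \<subseteq> {I. ideal I R}" and "S \<noteq> {}"
  shows "\<exists>M\<in>S. \<forall>I\<in>S. M \<subseteq> I \<longrightarrow> I = M"
proof -
  have "\<Union>C \<in> S" if C: "C \<noteq> {}" "subset.chain S C" for C
  proof -
    have "C \<subseteq> S" using C(2) unfolding subset.chain_def by simp
    have "subset.chain {I. ideal I R} C"
      using C(2) S unfolding subset.chain_def by auto
    then have "\<Union>C \<in> C"
      by (rule noetherian_ring.ideal_chain_is_trivial[OF assms(1) C(1)])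
    then show ?thesis using \<open>C \<subseteq> S\<close> by (rule subsetD[rotated])
  qed
  then show ?thesis by (rule subset_Zorn_nonempty[OF assms(3)])
qed

lemma (in cring) ideal_pow_closed:
  assumes "ideal I R" "a \<in> carrier R" "a [^] (k::nat) \<in> I" "k \<le> l"
  shows "a [^] l \<in> I"
proof -
  have "a [^] l = a [^] (l - k) \<otimes> a [^] k"
    using assms by (simp add: nat_pow_mult)
  then show ?thesis using assms by (simp add: ideal.I_l_closed)
qed

lemma (in cring) radical_Int:
  assumes "ideal I R" "ideal J R"
  shows "radical R (I \<inter> J) = radical R I \<inter> radical R J"
proof
  show "radical R I \<inter> radical R J \<subseteq> radical R (I \<inter> J)"
  proof
    fix a assume "a \<in> radical R I \<inter> radical R J"
    then obtain k l :: nat where "a \<in> carrier R" "a [^] k \<in> I" "a [^] l \<in> J"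
      unfolding radical_def by auto
    then have "a [^] (k + l) \<in> I \<inter> J"
      using ideal_pow_closed[OF assms(1), of a k "k + l"] ideal_pow_closed[OF assms(2), of a l "k + l"]
      by auto
    then show "a \<in> radical R (I \<inter> J)"
      using \<open>a \<in> carrier R\<close> unfolding radical_def by blast
  qed
qed (auto simp: radical_def)

lemma (in cring) subset_radical:
  assumes "ideal I R" shows "I \<subseteq> radical R I"
proof
  fix a assume a: "a \<in> I"
  then have "a \<in> carrier R" using assms by (simp add: ideal.Icarr)
  moreover have "a [^] (1::nat) \<in> I" using a \<open>a \<in> carrier R\<close> by simp
  ultimately show "a \<in> radical R I" unfolding radical_def by blast
qed

lemma (in cring) primary_ideal_Int:
  assumes P: "primary_ideal R P" and Q: "primary_ideal R Q" and eq: "radical R P = radical R Q"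
  shows "primary_ideal R (P \<inter> Q)" and "radical R (P \<inter> Q) = radical R Q"
proof -
  have ids: "ideal P R" "ideal Q R" using P Q unfolding primary_ideal_def by auto
  show rad: "radical R (P \<inter> Q) = radical R Q"
    using radical_Int[OF ids] eq by simp
  have "P \<noteq> carrier R" using P unfolding primary_ideal_def by blast
  moreover have "P \<subseteq> carrier R" using ids(1) by (auto simp: ideal.Icarr)
  ultimately have "P \<inter> Q \<noteq> carrier R" by blast
  moreover have "a \<in> P \<inter> Q \<or> b \<in> radical R (P \<inter> Q)"
    if "a \<in> carrier R" "b \<in> carrier R" "a \<otimes> b \<in> P \<inter> Q" for a b
    using that P Q eq unfolding rad unfolding primary_ideal_def by blast
  ultimately show "primary_ideal R (P \<inter> Q)"
    using i_intersect[OF ids] unfolding primary_ideal_def by blast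
qed

text \<open>Noetherian induction. An ideal \<open>M\<close> that is maximal without a primary decomposition
  is not primary: \<open>a b \<in> M\<close> with \<open>a \<notin> M\<close> and no power of \<open>b\<close> in \<open>M\<close>. Where the ascending
  chain of the colon ideals \<open>M : b\<^sup>k\<close> is stationary, \<open>M\<close> is the intersection of the strictly
  larger ideals \<open>M + (a)\<close> and \<open>M + (b\<^sup>k)\<close>, which do have decompositions.\<close>

lemma (in cring) primary_decomposition_exists:
  assumes noeth: "noetherian_ring R" and "ideal I R"
  shows "\<exists>D. finite D \<and> (\<forall>Q\<in>D. primary_ideal R Q) \<and> I = carrier R \<inter> \<Inter>D"
proof (rule ccontr)
  define dec where "dec I \<longleftrightarrow> (\<exists>D. finite D \<and> (\<forall>Q\<in>D. primary_ideal R Q) \<and> I = carrier R \<inter> \<Inter>D)" for I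
  have decI: "dec I" if "finite D" "\<forall>Q\<in>D. primary_ideal R Q" "I = carrier R \<inter> \<Inter>D" for I D
    using that unfolding dec_def by blast
  assume "\<not> ?thesis"
  then have "\<not> dec I" unfolding dec_def .
  then have "{I. ideal I R \<and> \<not> dec I} \<noteq> {}" using assms(2) by auto
  from noetherian_maximal_ideal[OF noeth _ this]
  have "\<exists>M\<in>{I. ideal I R \<and> \<not> dec I}. \<forall>I\<in>{I. ideal I R \<and> \<not> dec I}. M \<subseteq> I \<longrightarrow> I = M"
    by auto
  then obtain M where M: "ideal M R" and nM: "\<not> dec M"
    and max: "\<And>I. ideal I R \<Longrightarrow> \<not> dec I \<Longrightarrow> M \<subseteq> I \<Longrightarrow> I = M"
    by auto
  have Mc: "M \<subseteq> carrier R" using M by (auto simp: ideal.Icarr)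
  have "M \<noteq> carrier R"
    using nM decI[of "{}" M] by auto
  moreover have "\<not> primary_ideal R M"
  proof
    assume "primary_ideal R M"
    then show False using nM decI[of "{M}" M] Mc by auto
  qed
  ultimately obtain a b where ab: "a \<in> carrier R" "b \<in> carrier R" "a \<otimes> b \<in> M" "a \<notin> M"
    and b: "\<And>k::nat. b [^] k \<notin> M"
    using M unfolding primary_ideal_def radical_def by blast
  define J where "J k = {x \<in> carrier R. b [^] (k::nat) \<otimes> x \<in> M}" for k
  have idJ: "ideal (J k) R" for k
    unfolding J_def using ideal.helper_max_prime[OF M is_cring] ab by simp
  obtain N where N: "\<And>k. J N \<subseteq> J k \<Longrightarrow> J k = J N"
  proof -
    have "range J \<subseteq> {I. ideal I R}" "range J \<noteq> {}" using idJ by auto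
    from noetherian_maximal_ideal[OF noeth this] show thesis using that by auto
  qed
  have "J N \<subseteq> J (Suc N)"
  proof
    fix x assume x: "x \<in> J N"
    have "b [^] Suc N \<otimes> x = b \<otimes> (b [^] N \<otimes> x)"
      using x ab by (simp add: J_def m_ac)
    then show "x \<in> J (Suc N)"
      using x ab M by (simp add: J_def ideal.I_l_closed)
  qed
  then have stat: "J (Suc N) = J N" using N by blast
  define A where "A = M <+>\<^bsub>R\<^esub> PIdl a"
  define B where "B = M <+>\<^bsub>R\<^esub> PIdl (b [^] N)"
  have bN: "b [^] N \<in> carrier R" using ab by simp
  have idA: "ideal A R" and idB: "ideal B R"
    unfolding A_def B_def using M ab bN by (simp_all add: add_ideals cgenideal_ideal)
  have larger: "M \<subseteq> M <+>\<^bsub>R\<^esub> PIdl c \<and> c \<in> M <+>\<^bsub>R\<^esub> PIdl c" if c: "c \<in> carrier R" for c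
  proof -
    have "\<zero> \<in> M" "\<zero> \<in> PIdl c"
      using M cgenideal_ideal[OF c] by (simp_all add: additive_subgroup.zero_closed ideal.axioms(1))
    moreover have "c \<in> PIdl c" using c by (rule cgenideal_self)
    moreover have "m = m \<oplus> \<zero>" if "m \<in> M" for m using that Mc by auto
    moreover have "c = \<zero> \<oplus> c" using c by simp
    ultimately show ?thesis unfolding set_add_def' by blast
  qed
  have "dec A" and "dec B"
    using max[OF idA] max[OF idB] larger[OF ab(1)] larger[OF bN] ab(4) b
    unfolding A_def B_def by metis+
  have "A \<inter> B = M"
  proof
    show "M \<subseteq> A \<inter> B" using larger[OF ab(1)] larger[OF bN] unfolding A_def B_def by blast
    show "A \<inter> B \<subseteq> M"
    proof
      fix z assume "z \<in> A \<inter> B"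
      then obtain m r m' s where z: "z = m \<oplus> r \<otimes> a" "m \<in> M" "r \<in> carrier R"
        and z': "z = m' \<oplus> s \<otimes> b [^] N" "m' \<in> M" "s \<in> carrier R"
        unfolding A_def B_def set_add_def' cgenideal_def by blast
      have mc: "m \<in> carrier R" "m' \<in> carrier R" using z z' Mc by auto
      have bz: "b \<otimes> z \<in> M"
      proof -
        have "b \<otimes> z = b \<otimes> m \<oplus> r \<otimes> (a \<otimes> b)" using z ab mc by (simp add: r_distr m_ac)
        then show ?thesis using z ab M
          by (simp add: additive_subgroup.a_closed ideal.axioms(1) ideal.I_l_closed)
      qed
      have cancel: "u \<oplus> w \<ominus> u = w" if "u \<in> carrier R" "w \<in> carrier R" for u w
        using that by algebra
      have "b \<otimes> z = b \<otimes> m' \<oplus> b [^] Suc N \<otimes> s"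
        using z' ab mc bN by (simp add: r_distr m_ac)
      then have "b [^] Suc N \<otimes> s = b \<otimes> z \<ominus> b \<otimes> m'"
        using cancel[of "b \<otimes> m'" "b [^] Suc N \<otimes> s"] z' ab mc by simp
      also have "\<dots> \<in> M"
        using bz z' ab M unfolding a_minus_def
        by (simp add: additive_subgroup.a_closed additive_subgroup.a_inv_closed ideal.axioms(1) ideal.I_l_closed)
      finally have "s \<in> J (Suc N)" using z' unfolding J_def by simp
      then have "s \<in> J N" using stat by simp
      then have "s \<otimes> b [^] N \<in> M" using bN by (simp add: J_def m_comm[of s])
      then show "z \<in> M" using z' M by (simp add: additive_subgroup.a_closed ideal.axioms(1))
    qed
  qed
  moreover obtain D where D: "finite D" "\<forall>Q\<in>D. primary_ideal R Q" "A = carrier R \<inter> \<Inter>D"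
    using \<open>dec A\<close> unfolding dec_def by blast
  moreover obtain E where E: "finite E" "\<forall>Q\<in>E. primary_ideal R Q" "B = carrier R \<inter> \<Inter>E"
    using \<open>dec B\<close> unfolding dec_def by blast
  moreover have "carrier R \<inter> \<Inter>(D \<union> E) = (carrier R \<inter> \<Inter>D) \<inter> (carrier R \<inter> \<Inter>E)" by auto
  ultimately have "M = carrier R \<inter> \<Inter>(D \<union> E)" by simp
  moreover have "finite (D \<union> E)" "\<forall>Q\<in>D \<union> E. primary_ideal R Q" using D E by auto
  ultimately have "dec M" using decI by simp
  then show False using nM by blast
qed

text \<open>A decomposition with the fewest components is minimal: a superfluous component could be
  omitted, and two components with the same radical could be replaced by their intersection.\<close>

lemma (in cring) minimal_primary_decomposition_exists:
  assumes "noetherian_ring R" and "ideal I R"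
  shows "\<exists>D. minimal_primary_decomposition R I D"
proof -
  let ?dec = "\<lambda>D. finite D \<and> (\<forall>Q\<in>D. primary_ideal R Q) \<and> I = carrier R \<inter> \<Inter>D"
  obtain D where D: "?dec D" and least: "\<And>E. ?dec E \<Longrightarrow> card D \<le> card E"
    using ex_has_least_nat[of ?dec _ card] primary_decomposition_exists[OF assms] by metis
  have "inj_on (radical R) D"
  proof (rule inj_onI, rule ccontr)
    fix P Q assume PQ: "P \<in> D" "Q \<in> D" "radical R P = radical R Q" "P \<noteq> Q"
    let ?E = "insert (P \<inter> Q) (D - {P, Q})"
    have "?dec ?E"
      using D PQ primary_ideal_Int(1)[of P Q] by auto
    then have "card D \<le> card ?E" by (rule least)
    also have "\<dots> \<le> Suc (card (D - {P, Q}))"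
      using D by (simp add: card_insert_if)
    finally have "card D \<le> Suc (card (D - {P, Q}))" .
    moreover have "card (D - {P, Q}) = card D - 2"
      using D PQ by (simp add: card_Diff_subset)
    moreover have "card {P, Q} \<le> card D"
      using D PQ by (intro card_mono) auto
    ultimately show False using PQ by simp
  qed
  moreover have "\<not> carrier R \<inter> \<Inter>(D - {Q}) \<subseteq> Q" if Q: "Q \<in> D" for Q
  proof
    assume "carrier R \<inter> \<Inter>(D - {Q}) \<subseteq> Q"
    then have "carrier R \<inter> \<Inter>(D - {Q}) = carrier R \<inter> \<Inter>D" using Q by auto
    then have "?dec (D - {Q})" using D by simp
    then have "card D \<le> card (D - {Q})" by (rule least)
    then show False using card_Diff1_less[of D Q] D Q by simp
  qed
  ultimately have "minimal_primary_decomposition R I D"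
    using D unfolding minimal_primary_decomposition_def by simp
  then show ?thesis ..
qed

lemma (in cring) radical_prime:
  assumes Q: "primary_ideal R Q" and "a \<in> carrier R" "b \<in> carrier R"
    and ab: "a \<otimes> b \<in> radical R Q"
  shows "a \<in> radical R Q \<or> b \<in> radical R Q"
proof (rule disjCI)
  assume b: "b \<notin> radical R Q"
  obtain k :: nat where "(a \<otimes> b) [^] k \<in> Q" using ab unfolding radical_def by blast
  then have "a [^] k \<otimes> b [^] k \<in> Q" using assms by (simp add: nat_pow_distrib)
  moreover have "b [^] k \<notin> radical R Q"
    using b assms by (auto simp: radical_def nat_pow_pow)
  ultimately have "a [^] k \<in> Q"
    using Q assms unfolding primary_ideal_def by (metis nat_pow_closed)
  then show "a \<in> radical R Q" using assms unfolding radical_def by blast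
qed

text \<open>Multiplying one witness from each ideal gives an element of the intersection. It stays
  outside the radical because the radical of a primary ideal is prime.\<close>

lemma (in cring) Inter_not_subset_radical:
  assumes Q: "primary_ideal R Q" and "finite D"
    and "\<And>P. P \<in> D \<Longrightarrow> ideal P R" and "\<And>P. P \<in> D \<Longrightarrow> \<not> P \<subseteq> radical R Q"
  shows "\<exists>u \<in> carrier R \<inter> \<Inter>D. u \<notin> radical R Q"
  using assms(2-)
proof (induction D rule: finite_induct)
  case empty
  have "\<one> \<notin> radical R Q"
    using Q ideal.one_imp_carrier unfolding radical_def primary_ideal_def by (auto simp: nat_pow_one)
  then show ?case by (intro bexI[of _ \<one>]) auto
next
  case (insert P D)
  then obtain u where u: "u \<in> carrier R" "u \<in> \<Inter>D" "u \<notin> radical R Q" by auto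
  obtain v where v: "v \<in> P" "v \<notin> radical R Q" using insert.prems by blast
  have "v \<in> carrier R" using v ideal.Icarr[of P R] insert.prems(1)[of P] by simp
  then have "u \<otimes> v \<in> carrier R \<inter> \<Inter>(insert P D)"
    using u v insert.prems by (auto simp: ideal.I_l_closed ideal.I_r_closed)
  moreover have "u \<otimes> v \<notin> radical R Q"
    using radical_prime[OF Q] u v \<open>v \<in> carrier R\<close> by blast
  ultimately show ?case by blast
qed

text \<open>The condition \<open>g Q \<subseteq> I \<subseteq> Q\<close> with \<open>g\<close> outside the radical \<open>P\<close> of \<open>Q\<close> says that \<open>I\<close> and
  \<open>Q\<close> agree after localization at \<open>P\<close>. In a minimal decomposition of \<open>I\<close>, a component \<open>Q'\<close>
  with radical inside \<open>P\<close> contains \<open>Q\<close> (cancel \<open>g\<close>), so that its radical is \<open>P\<close>; there is such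
  a component, since otherwise the intersection \<open>I\<close> would not lie in \<open>P\<close>. Cancelling an element
  of the other components gives \<open>Q' \<subseteq> Q\<close> as well.\<close>

lemma (in cring) isolated_primary_componentI:
  assumes "noetherian_ring R" and I: "ideal I R" and Q: "primary_ideal R Q" and IQ: "I \<subseteq> Q"
    and g: "g \<in> carrier R" "g \<notin> radical R Q" and gQ: "\<And>q. q \<in> Q \<Longrightarrow> g \<otimes> q \<in> I"
  shows "isolated_primary_component R I (radical R Q) Q"
proof -
  let ?P = "radical R Q"
  have idQ: "ideal Q R" using Q unfolding primary_ideal_def by blast
  obtain D where D: "minimal_primary_decomposition R I D"
    using minimal_primary_decomposition_exists[OF assms(1) I] by blast
  then have fin: "finite D" and prim: "\<And>P. P \<in> D \<Longrightarrow> primary_ideal R P"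
    and I_eq: "I = carrier R \<inter> \<Inter>D" and inj: "inj_on (radical R) D"
    unfolding minimal_primary_decomposition_def by auto
  then have ids: "\<And>P. P \<in> D \<Longrightarrow> ideal P R" unfolding primary_ideal_def by blast
  have below: "Q \<subseteq> P \<and> radical R P = ?P" if P: "P \<in> D" "radical R P \<subseteq> ?P" for P
  proof -
    have "Q \<subseteq> P"
    proof
      fix q assume q: "q \<in> Q"
      then have "q \<otimes> g \<in> P"
        using gQ[OF q] I_eq P g idQ by (metis IntD2 InterE ideal.Icarr m_comm)
      then show "q \<in> P"
        using prim[OF P(1)] q g P idQ unfolding primary_ideal_def by (meson ideal.Icarr subsetD)
    qed
    then have "?P \<subseteq> radical R P" unfolding radical_def by blast
    then show ?thesis using P \<open>Q \<subseteq> P\<close> by blast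
  qed
  have sub_rad: "radical R P \<subseteq> ?P" if P: "P \<in> D" "P \<subseteq> ?P" for P
  proof
    fix a assume "a \<in> radical R P"
    then obtain k :: nat where a: "a \<in> carrier R" "a [^] k \<in> ?P" using P unfolding radical_def by blast
    then obtain l :: nat where "(a [^] k) [^] l \<in> Q" unfolding radical_def by blast
    then show "a \<in> ?P" using a by (auto simp: radical_def nat_pow_pow)
  qed
  have "\<exists>P\<in>D. P \<subseteq> ?P"
  proof (rule ccontr)
    assume "\<not> ?thesis"
    then obtain u where "u \<in> carrier R \<inter> \<Inter>D" "u \<notin> ?P"
      using Inter_not_subset_radical[OF Q fin ids] by blast
    then show False using I_eq IQ subset_radical[OF idQ] by blast
  qed
  then obtain P where P: "P \<in> D" "P \<subseteq> ?P" ..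
  then have QP: "Q \<subseteq> P" and radP: "radical R P = ?P" using below sub_rad by auto
  have "\<not> P' \<subseteq> ?P" if P': "P' \<in> D - {P}" for P'
  proof
    assume "P' \<subseteq> ?P"
    then have "radical R P' = radical R P" using below[of P'] sub_rad[of P'] P' radP by simp
    then show False using inj_onD[OF inj, of P' P] P' P by simp
  qed
  then have "\<exists>u \<in> carrier R \<inter> \<Inter>(D - {P}). u \<notin> ?P"
    by (intro Inter_not_subset_radical[OF Q]) (auto simp: fin ids)
  then obtain u where u: "u \<in> carrier R \<inter> \<Inter>(D - {P})" "u \<notin> ?P" ..
  have "P \<subseteq> Q"
  proof
    fix p assume p: "p \<in> P"
    then have pc: "p \<in> carrier R" using ideal.Icarr[OF ids[OF P(1)]] by simp
    have "p \<otimes> u \<in> P'" if P': "P' \<in> D" for P'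
    proof (cases "P' = P")
      case True
      then show ?thesis using p u ideal.I_r_closed[OF ids[OF P(1)]] by simp
    next
      case False
      then have "u \<in> P'" using u P' by blast
      then show ?thesis using pc ideal.I_l_closed[OF ids[OF P']] by simp
    qed
    then have "p \<otimes> u \<in> I" using I_eq pc u by simp
    then have "p \<otimes> u \<in> Q" using IQ by (rule subsetD[rotated])
    then show "p \<in> Q" using Q pc u unfolding primary_ideal_def by blast
  qed
  then have "P = Q" using QP by simp
  then show ?thesis
    using D P(1) below unfolding isolated_primary_component_def by (auto intro!: exI[of _ D])
qed

section \<open>Substitution and derivations of polynomials\<close>

lemma single_add_exponents:
  "Poly_Mapping.single (m + m') (1::'a::comm_semiring_1) = Poly_Mapping.single m 1 * Poly_Mapping.single m' 1"
  by (simp add: mult_single)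

lemma single_sum_exponents:
  "Poly_Mapping.single (\<Sum>v\<in>A. e v) (1::'a::comm_semiring_1) = (\<Prod>v\<in>A. Poly_Mapping.single (e v) 1)"
  by (induction A rule: infinite_finite_induct) (simp_all add: single_add_exponents)

lemma single_var_power:
  "Poly_Mapping.single (Poly_Mapping.single v k) (1::'a::comm_semiring_1) = var_mp v ^ k"
proof (induction k)
  case (Suc k)
  have "Poly_Mapping.single v (Suc k) = Poly_Mapping.single v 1 + Poly_Mapping.single v k"
    by (simp flip: single_add)
  then show ?case
    using Suc by (simp add: single_add_exponents var_mp_def)
qed simp

lemma poly_mapping_sum_single:
  "(\<Sum>m\<in>Poly_Mapping.keys p. Poly_Mapping.single m (Poly_Mapping.lookup p m)) = p"
  by (rule poly_mapping_eqI) (auto simp: lookup_sum lookup_single when_def in_keys_iff)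

lemma single_eq_const_times_vars:
  "Poly_Mapping.single m (c::'a::comm_semiring_1)
     = const_mp c * (\<Prod>v\<in>Poly_Mapping.keys m. var_mp v ^ Poly_Mapping.lookup m v)"
proof -
  have "Poly_Mapping.single m (1::'a) = (\<Prod>v\<in>Poly_Mapping.keys m. var_mp v ^ Poly_Mapping.lookup m v)"
    using single_sum_exponents[of "\<lambda>v. Poly_Mapping.single v (Poly_Mapping.lookup m v)" "Poly_Mapping.keys m"]
    unfolding poly_mapping_sum_single by (simp add: single_var_power)
  moreover have "Poly_Mapping.single m c = const_mp c * Poly_Mapping.single m 1"
    by (simp add: const_mp_def mult_single)
  ultimately show ?thesis by simp
qed

lemma const_mp_hom: "comm_ring_hom (const_mp :: 'a::comm_ring_1 \<Rightarrow> 'a mpoly)"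
  by unfold_locales (simp_all add: const_mp_def single_add mult_single)

lemma const_mp_0 [simp]: "const_mp 0 = 0"
  and const_mp_1 [simp]: "const_mp 1 = 1"
  by (simp_all add: const_mp_def)

lemma sum_closed_under_add:
  assumes "P 0" and "\<And>p q. P p \<Longrightarrow> P q \<Longrightarrow> P (p + q)" and "\<And>a. a \<in> A \<Longrightarrow> P (f a)"
  shows "P (\<Sum>a\<in>A. f a)"
  using assms(3) by (induction A rule: infinite_finite_induct) (auto simp: assms(1,2))

lemma prod_closed_under_mult:
  assumes "P 1" and "\<And>p q. P p \<Longrightarrow> P q \<Longrightarrow> P (p * q)" and "\<And>a. a \<in> A \<Longrightarrow> P (f a)"
  shows "P (\<Prod>a\<in>A. f a)"
  using assms(3) by (induction A rule: infinite_finite_induct) (auto simp: assms(1,2))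

lemma mpoly_monomial_induct [case_names single add]:
  fixes p :: "'a::comm_semiring_1 mpoly"
  assumes "\<And>m c. P (Poly_Mapping.single m c)" and "\<And>p q. P p \<Longrightarrow> P q \<Longrightarrow> P (p + q)"
  shows "P p"
proof -
  have "P 0" using assms(1)[of 0 0] by simp
  then have "P (\<Sum>m\<in>Poly_Mapping.keys p. Poly_Mapping.single m (Poly_Mapping.lookup p m))"
    by (rule sum_closed_under_add[where P = P]) (auto intro: assms)
  then show ?thesis by (simp add: poly_mapping_sum_single)
qed

text \<open>Since constants and variables generate all polynomials, homomorphisms and derivations can be
  compared on the variables. All chain rules below are proved in this way.\<close>

lemma mpoly_induct [consumes 1, case_names const var add mult]:
  fixes p :: "'a::comm_semiring_1 mpoly"
  assumes "vars_mp p \<subseteq> V" and const: "\<And>c. P (const_mp c)" and var: "\<And>v. v \<in> V \<Longrightarrow> P (var_mp v)"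
    and add: "\<And>p q. P p \<Longrightarrow> P q \<Longrightarrow> P (p + q)" and mult: "\<And>p q. P p \<Longrightarrow> P q \<Longrightarrow> P (p * q)"
  shows "P p"
proof -
  have "P 0" "P 1" using const[of 0] const[of 1] by simp_all
  have pow: "P (var_mp v ^ k)" if "v \<in> V" for v k
    by (induction k) (use that var mult \<open>P 1\<close> in auto)
  have "P (Poly_Mapping.single m (Poly_Mapping.lookup p m))" if "m \<in> Poly_Mapping.keys p" for m
  proof -
    have "v \<in> V" if "v \<in> Poly_Mapping.keys m" for v
      using that \<open>m \<in> _\<close> assms(1) unfolding vars_mp_def by auto
    then have "P (\<Prod>v\<in>Poly_Mapping.keys m. var_mp v ^ Poly_Mapping.lookup m v)"
      by (intro prod_closed_under_mult[where P = P] pow mult \<open>P 1\<close>)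
    then show ?thesis unfolding single_eq_const_times_vars by (rule mult[OF const])
  qed
  then have "P (\<Sum>m\<in>Poly_Mapping.keys p. Poly_Mapping.single m (Poly_Mapping.lookup p m))"
    by (intro sum_closed_under_add[where P = P] add \<open>P 0\<close>)
  then show ?thesis by (simp add: poly_mapping_sum_single)
qed

lemma vars_const_mp [simp]: "vars_mp (const_mp c) = {}"
  by (auto simp: vars_mp_def const_mp_def)

lemma vars_var_mp [simp]: "vars_mp (var_mp v :: 'a::zero_neq_one mpoly) = {v}"
  by (auto simp: vars_mp_def var_mp_def)

lemma vars_mp_add: "vars_mp (p + q) \<subseteq> vars_mp p \<union> vars_mp q"
  using keys_add[of p q] unfolding vars_mp_def by blast

lemma vars_mp_mult:
  fixes p q :: "'a::comm_semiring_1 mpoly"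
  shows "vars_mp (p * q) \<subseteq> vars_mp p \<union> vars_mp q"
  using keys_mult[of p q] keys_add unfolding vars_mp_def by fastforce

lemma vars_mp_uminus [simp]: "vars_mp (- p) = vars_mp (p :: 'a::ab_group_add mpoly)"
  unfolding vars_mp_def by (simp add: Poly_Mapping.keys_def)

lemma vars_mp_0 [simp]: "vars_mp 0 = {}"
  by (simp add: vars_mp_def)

lemma vars_mp_1 [simp]: "vars_mp (1 :: 'a::zero_neq_one mpoly) = {}"
  by (auto simp: vars_mp_def)

definition subring_set :: "'b::comm_ring_1 set \<Rightarrow> bool" where
  "subring_set S \<longleftrightarrow> 0 \<in> S \<and> 1 \<in> S \<and> (\<forall>p\<in>S. \<forall>q\<in>S. p + q \<in> S \<and> p * q \<in> S) \<and> (\<forall>p\<in>S. - p \<in> S)"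

lemma subring_setD:
  assumes "subring_set S"
  shows "0 \<in> S" "1 \<in> S" "p \<in> S \<Longrightarrow> q \<in> S \<Longrightarrow> p + q \<in> S" "p \<in> S \<Longrightarrow> q \<in> S \<Longrightarrow> p * q \<in> S"
    "p \<in> S \<Longrightarrow> - p \<in> S" "p \<in> S \<Longrightarrow> q \<in> S \<Longrightarrow> p - q \<in> S" "p \<in> S \<Longrightarrow> p ^ k \<in> S"
proof -
  show S: "0 \<in> S" "1 \<in> S" "p \<in> S \<Longrightarrow> q \<in> S \<Longrightarrow> p + q \<in> S" "p \<in> S \<Longrightarrow> q \<in> S \<Longrightarrow> p * q \<in> S"
    "p \<in> S \<Longrightarrow> - p \<in> S" for p q
    using assms unfolding subring_set_def by auto
  show "p \<in> S \<Longrightarrow> q \<in> S \<Longrightarrow> p - q \<in> S" using S(3)[of p "- q"] S(5)[of q] by simp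
  show "p \<in> S \<Longrightarrow> p ^ k \<in> S" by (induction k) (simp_all add: S(2,4))
qed

lemma vars_mp_subring: "subring_set {p :: 'a::comm_ring_1 mpoly. vars_mp p \<subseteq> V}"
proof -
  have "vars_mp (p + q) \<subseteq> V \<and> vars_mp (p * q) \<subseteq> V"
    if "vars_mp p \<subseteq> V" "vars_mp q \<subseteq> V" for p q :: "'a mpoly"
    using that vars_mp_add[of p q] vars_mp_mult[of p q] by auto
  moreover have "vars_mp (0 :: 'a mpoly) = {}" "vars_mp (1 :: 'a mpoly) = {}"
    by (auto simp: vars_mp_def)
  ultimately show ?thesis unfolding subring_set_def by simp
qed

lemma insertion_mp_supset:
  assumes "finite A" "Poly_Mapping.keys p \<subseteq> A" "h 0 = 0"
  shows "insertion_mp h s p = (\<Sum>m\<in>A. h (Poly_Mapping.lookup p m) *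
           (\<Prod>v\<in>Poly_Mapping.keys m. s v ^ Poly_Mapping.lookup m v))"
  unfolding insertion_mp_def using assms
  by (intro sum.mono_neutral_left) (auto simp: in_keys_iff)

lemma insertion_mp_single:
  assumes "h 0 = 0"
  shows "insertion_mp h s (Poly_Mapping.single m c)
           = h c * (\<Prod>v\<in>Poly_Mapping.keys m. s v ^ Poly_Mapping.lookup m v)"
  using insertion_mp_supset[of "{m}" "Poly_Mapping.single m c" h s] assms by simp

lemma prod_powers_add:
  fixes s :: "var \<Rightarrow> 'b::comm_semiring_1"
  shows "(\<Prod>v\<in>Poly_Mapping.keys (m + m'). s v ^ Poly_Mapping.lookup (m + m') v)
     = (\<Prod>v\<in>Poly_Mapping.keys m. s v ^ Poly_Mapping.lookup m v)
       * (\<Prod>v\<in>Poly_Mapping.keys m'. s v ^ Poly_Mapping.lookup m' v)"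
proof -
  let ?A = "Poly_Mapping.keys m \<union> Poly_Mapping.keys m'"
  have supp: "(\<Prod>v\<in>Poly_Mapping.keys k. s v ^ Poly_Mapping.lookup k v) = (\<Prod>v\<in>?A. s v ^ Poly_Mapping.lookup k v)"
    if "Poly_Mapping.keys k \<subseteq> ?A" for k
    using that by (intro prod.mono_neutral_left) (auto simp: in_keys_iff)
  show ?thesis
    unfolding supp[OF keys_add] supp[OF Un_upper1] supp[OF Un_upper2]
    by (simp add: lookup_add power_add prod.distrib)
qed

lemma insertion_mp_hom:
  assumes "comm_ring_hom h"
  shows "comm_ring_hom (insertion_mp h s)"
proof -
  interpret h: comm_ring_hom h by fact
  have add: "insertion_mp h s (p + q) = insertion_mp h s p + insertion_mp h s q" for p q
  proof -
    let ?A = "Poly_Mapping.keys p \<union> Poly_Mapping.keys q"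
    have supp: "insertion_mp h s r = (\<Sum>m\<in>?A. h (Poly_Mapping.lookup r m) *
        (\<Prod>v\<in>Poly_Mapping.keys m. s v ^ Poly_Mapping.lookup m v))" if "Poly_Mapping.keys r \<subseteq> ?A" for r
      using that by (intro insertion_mp_supset) simp_all
    show ?thesis
      unfolding supp[OF keys_add] supp[OF Un_upper1] supp[OF Un_upper2]
      by (simp add: lookup_add h.hom_add distrib_right sum.distrib)
  qed
  have "insertion_mp h s (p * q) = insertion_mp h s p * insertion_mp h s q" for p q
  proof (induction p rule: mpoly_monomial_induct)
    case (single m c)
    show ?case
      by (induction q rule: mpoly_monomial_induct)
        (simp_all add: mult_single insertion_mp_single prod_powers_add h.hom_mult distrib_left distrib_right add mult_ac)
  qed (simp add: distrib_right add)
  moreover have "insertion_mp h s 0 = 0" by (simp add: insertion_mp_def)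
  moreover have "insertion_mp h s 1 = 1"
    using insertion_mp_single[of h s 0 1] by simp
  ultimately show ?thesis using add by unfold_locales
qed

lemma insertion_mp_const [simp]:
  assumes "h 0 = 0" shows "insertion_mp h s (const_mp c) = h c"
  using assms by (simp add: const_mp_def insertion_mp_single)

lemma insertion_mp_var [simp]:
  assumes "comm_ring_hom h" shows "insertion_mp h s (var_mp v) = s v"
proof -
  interpret h: comm_ring_hom h by fact
  show ?thesis by (simp add: var_mp_def insertion_mp_single)
qed

lemma ring_hom_eq_on_mpoly:
  fixes p :: "'a::comm_ring_1 mpoly"
  assumes "comm_ring_hom \<phi>" "comm_ring_hom \<psi>" "vars_mp p \<subseteq> V"
    and "\<And>c. \<phi> (const_mp c) = \<psi> (const_mp c)" and "\<And>v. v \<in> V \<Longrightarrow> \<phi> (var_mp v) = \<psi> (var_mp v)"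
  shows "\<phi> p = \<psi> p"
proof -
  interpret \<phi>: comm_ring_hom \<phi> by fact
  interpret \<psi>: comm_ring_hom \<psi> by fact
  show ?thesis using assms(3)
    by (induction p rule: mpoly_induct) (simp_all add: assms \<phi>.hom_add \<psi>.hom_add \<phi>.hom_mult \<psi>.hom_mult)
qed

lemma comm_ring_hom_comp:
  "comm_ring_hom f \<Longrightarrow> comm_ring_hom g \<Longrightarrow> comm_ring_hom (\<lambda>x. f (g x))"
proof -
  assume "comm_ring_hom f" "comm_ring_hom g"
  then interpret f: comm_ring_hom f + g: comm_ring_hom g by auto
  show ?thesis by unfold_locales (simp_all add: f.hom_add f.hom_mult g.hom_add g.hom_mult)
qed

lemma id_hom: "comm_ring_hom (\<lambda>c. c)"
  by unfold_locales simp_all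

lemma constant_poly_hom: "comm_ring_hom (\<lambda>c. [:c:])"
  by unfold_locales (simp_all add: one_pCons)

lemma poly_hom: "comm_ring_hom (\<lambda>p. poly p y)"
  by unfold_locales simp_all

lemma map_poly_hom:
  assumes "comm_ring_hom h" shows "comm_ring_hom (map_poly h)"
proof -
  interpret h: comm_ring_hom h by fact
  show ?thesis
    by unfold_locales (auto intro!: poly_eqI simp: coeff_map_poly coeff_mult h.hom_add h.hom_mult h.hom_sum)
qed

lemma eval_mp_hom: "comm_ring_hom (eval_mp pt)"
  by (rule insertion_mp_hom[OF id_hom])

text \<open>The codomain is a module over the polynomials through \<open>\<phi>\<close>. If \<open>\<phi>\<close> is evaluation at a point,
  these are the tangent vectors at the point; if \<open>\<phi>\<close> is substitution of an arc, they are the vector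
  fields along the arc.\<close>

definition derivation_along :: "('a::comm_ring_1 mpoly \<Rightarrow> 'b::comm_ring_1) \<Rightarrow> ('a mpoly \<Rightarrow> 'b) \<Rightarrow> bool" where
  "derivation_along \<phi> D \<longleftrightarrow> (\<forall>c. D (const_mp c) = 0) \<and> (\<forall>p q. D (p + q) = D p + D q) \<and>
     (\<forall>p q. D (p * q) = D p * \<phi> q + \<phi> p * D q)"

lemma derivation_alongI:
  assumes "\<And>c. D (const_mp c) = 0" and "\<And>p q. D (p + q) = D p + D q"
    and "\<And>p q. D (p * q) = D p * \<phi> q + \<phi> p * D q"
  shows "derivation_along \<phi> D"
  using assms unfolding derivation_along_def by blast

lemma derivation_along_const: "derivation_along \<phi> D \<Longrightarrow> D (const_mp c) = 0"
  and derivation_along_add: "derivation_along \<phi> D \<Longrightarrow> D (p + q) = D p + D q"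
  and derivation_along_mult: "derivation_along \<phi> D \<Longrightarrow> D (p * q) = D p * \<phi> q + \<phi> p * D q"
  unfolding derivation_along_def by blast+

lemma derivation_along_eq:
  assumes D: "derivation_along \<phi> D" and E: "derivation_along \<phi> E" and "vars_mp p \<subseteq> V"
    and "\<And>v. v \<in> V \<Longrightarrow> D (var_mp v) = E (var_mp v)"
  shows "D p = E p"
  using assms(3)
  by (induction p rule: mpoly_induct)
    (simp_all add: assms(4) derivation_along_const[OF D] derivation_along_const[OF E]
      derivation_along_add[OF D] derivation_along_add[OF E]
      derivation_along_mult[OF D] derivation_along_mult[OF E])

lemma derivation_along_zero [simp]: "derivation_along \<phi> (\<lambda>p. 0)"
  by (rule derivation_alongI) simp_all

lemma derivation_along_plus:
  "derivation_along \<phi> D \<Longrightarrow> derivation_along \<phi> E \<Longrightarrow> derivation_along \<phi> (\<lambda>p. D p + E p)"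
  by (rule derivation_alongI)
    (simp_all add: derivation_along_const derivation_along_add derivation_along_mult algebra_simps)

lemma derivation_along_scale:
  "derivation_along \<phi> D \<Longrightarrow> derivation_along \<phi> (\<lambda>p. c * D p)"
  by (rule derivation_alongI)
    (simp_all add: derivation_along_const derivation_along_add derivation_along_mult algebra_simps)

lemma derivation_along_sum:
  "(\<And>i. i \<in> A \<Longrightarrow> derivation_along \<phi> (D i)) \<Longrightarrow> derivation_along \<phi> (\<lambda>p. \<Sum>i\<in>A. D i p)"
  by (induction A rule: infinite_finite_induct) (simp_all add: derivation_along_plus)

lemma derivation_along_hom:
  assumes "derivation_along (\<lambda>p. p) D" and "comm_ring_hom \<phi>"
  shows "derivation_along \<phi> (\<lambda>p. \<phi> (D p))"
proof -
  interpret comm_ring_hom \<phi> by fact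
  show ?thesis
    by (rule derivation_alongI)
      (simp_all add: derivation_along_const[OF assms(1)] derivation_along_add[OF assms(1)]
        derivation_along_mult[OF assms(1)] hom_add hom_mult)
qed

lemma pdiff_supset:
  assumes "finite A" "Poly_Mapping.keys p \<subseteq> A"
  shows "pdiff v p = (\<Sum>m\<in>A. Poly_Mapping.single (m - Poly_Mapping.single v 1)
           (of_nat (Poly_Mapping.lookup m v) * Poly_Mapping.lookup p m))"
  unfolding pdiff_def using assms
  by (intro sum.mono_neutral_left) (auto simp: in_keys_iff)

lemma pdiff_single:
  "pdiff v (Poly_Mapping.single m c)
     = Poly_Mapping.single (m - Poly_Mapping.single v 1) (of_nat (Poly_Mapping.lookup m v) * c)"
  using pdiff_supset[of "{m}" "Poly_Mapping.single m c" v] by simp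

lemma pdiff_add: "pdiff v (p + q) = pdiff v p + pdiff v q"
proof -
  let ?A = "Poly_Mapping.keys p \<union> Poly_Mapping.keys q"
  have fin: "finite ?A" by simp
  show ?thesis
    using pdiff_supset[OF fin, of p] pdiff_supset[OF fin, of q] pdiff_supset[OF fin, of "p + q"] keys_add[of p q]
    by (simp add: lookup_add distrib_left single_add sum.distrib)
qed

lemma pdiff_mult_single:
  "pdiff v (Poly_Mapping.single m c * Poly_Mapping.single m' d)
     = pdiff v (Poly_Mapping.single m c) * Poly_Mapping.single m' d
       + Poly_Mapping.single m c * pdiff v (Poly_Mapping.single m' d)"
proof -
  let ?e = "Poly_Mapping.single v (1::nat)"
  \<comment> \<open>Subtraction of exponents is truncated; where it is not exact, the coefficient is 0.\<close>
  have shift: "k - ?e + k' = k + k' - ?e" if "Poly_Mapping.lookup k v \<noteq> 0" for k k' :: "var \<Rightarrow>\<^sub>0 nat"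
    using that by (intro poly_mapping_eqI) (auto simp: lookup_add lookup_minus lookup_single when_def)
  have "Poly_Mapping.single (k - ?e + k') (of_nat (Poly_Mapping.lookup k v) * x)
      = Poly_Mapping.single (k + k' - ?e) (of_nat (Poly_Mapping.lookup k v) * x)"
    for k k' and x :: 'a
    using shift[of k k'] by (cases "Poly_Mapping.lookup k v = 0") auto
  from this[of m m' "c * d"] this[of m' m "c * d"] show ?thesis
    by (simp add: pdiff_single mult_single lookup_add distrib_left distrib_right single_add ac_simps)
qed

lemma pdiff_mult:
  "pdiff v (p * q) = pdiff v p * q + p * pdiff v q"
proof (induction p rule: mpoly_monomial_induct)
  case (single m c)
  show ?case
    by (induction q rule: mpoly_monomial_induct)
      (simp_all add: pdiff_mult_single pdiff_add distrib_left distrib_right ac_simps)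
qed (simp add: distrib_left distrib_right pdiff_add ac_simps)

lemma pdiff_const [simp]: "pdiff v (const_mp c) = 0"
  by (simp add: const_mp_def pdiff_single)

lemma pdiff_var: "pdiff v (var_mp w) = (if v = w then 1 else 0)"
  by (auto simp: var_mp_def pdiff_single lookup_single)

lemma derivation_pdiff: "derivation_along (\<lambda>p. p) (pdiff v)"
  by (rule derivation_alongI) (simp_all add: pdiff_add pdiff_mult)

lemma pdiff_0 [simp]: "pdiff v 0 = 0" and pdiff_1 [simp]: "pdiff v 1 = 0"
  using pdiff_const[of v 0] pdiff_const[of v 1] by simp_all

lemma vars_mp_pdiff:
  fixes p :: "'a::comm_ring_1 mpoly"
  assumes "vars_mp p \<subseteq> V" shows "vars_mp (pdiff v p) \<subseteq> V"
proof -
  have S: "subring_set {p :: 'a mpoly. vars_mp p \<subseteq> V}" by (rule vars_mp_subring)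
  have "p \<in> {p. vars_mp p \<subseteq> V} \<and> pdiff v p \<in> {p. vars_mp p \<subseteq> V}"
    using assms
  proof (induction p rule: mpoly_induct)
    case (add p q)
    then show ?case unfolding pdiff_add by (intro conjI subring_setD(3)[OF S]) simp_all
  next
    case (mult p q)
    then show ?case unfolding pdiff_mult by (intro conjI subring_setD(3,4)[OF S]) simp_all
  qed (simp_all add: pdiff_var)
  then show ?thesis by simp
qed

section \<open>Hilbert's basis theorem\<close>

text \<open>Subrings and their ideals are plain sets inside one ring type, so that variables can be
  adjoined one after the other without a change of type.\<close>

definition ideal_of :: "'b::comm_ring_1 set \<Rightarrow> 'b set \<Rightarrow> bool" where
  "ideal_of S I \<longleftrightarrow> I \<subseteq> S \<and> 0 \<in> I \<and> (\<forall>p\<in>I. \<forall>q\<in>I. p + q \<in> I) \<and> (\<forall>s\<in>S. \<forall>p\<in>I. s * p \<in> I)"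

inductive_set ideal_gen :: "'b::comm_ring_1 set \<Rightarrow> 'b set \<Rightarrow> 'b set" for S A where
  zero: "0 \<in> ideal_gen S A"
| add: "s \<in> S \<Longrightarrow> a \<in> A \<Longrightarrow> p \<in> ideal_gen S A \<Longrightarrow> s * a + p \<in> ideal_gen S A"

definition ideals_fin_gen :: "'b::comm_ring_1 set \<Rightarrow> bool" where
  "ideals_fin_gen S \<longleftrightarrow> (\<forall>I. ideal_of S I \<longrightarrow> (\<exists>A\<subseteq>I. finite A \<and> I \<subseteq> ideal_gen S A))"

lemma ideal_gen_add: "p \<in> ideal_gen S A \<Longrightarrow> q \<in> ideal_gen S A \<Longrightarrow> p + q \<in> ideal_gen S A"
  by (induction p rule: ideal_gen.induct) (auto simp: add.assoc intro: ideal_gen.add)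

lemma ideal_gen_mult:
  assumes S: "subring_set S" "s \<in> S" and "p \<in> ideal_gen S A"
  shows "s * p \<in> ideal_gen S A"
  using assms(3)
proof (induction p rule: ideal_gen.induct)
  case (add r a p)
  have "s * r \<in> S" using S add unfolding subring_set_def by blast
  then have "s * r * a + s * p \<in> ideal_gen S A" using add by (intro ideal_gen.add)
  then show ?case by (simp add: distrib_left mult.assoc)
qed (simp add: ideal_gen.zero)

lemma ideal_gen_minimal: "p \<in> ideal_gen S A \<Longrightarrow> ideal_of S I \<Longrightarrow> A \<subseteq> I \<Longrightarrow> p \<in> I"
  by (induction p rule: ideal_gen.induct) (auto simp: ideal_of_def)

lemma ideals_fin_gen_image:
  assumes S: "subring_set S" and fg: "ideals_fin_gen S" and "comm_ring_hom \<phi>"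
  shows "ideals_fin_gen (\<phi> ` S)"
  unfolding ideals_fin_gen_def
proof (intro allI impI)
  interpret \<phi>: comm_ring_hom \<phi> by fact
  fix I assume I: "ideal_of (\<phi> ` S) I"
  define J where "J = {p. p \<in> S \<and> \<phi> p \<in> I}"
  have "ideal_of S J"
    using S I unfolding ideal_of_def subring_set_def J_def by (auto simp: \<phi>.hom_add \<phi>.hom_mult)
  then obtain A where A: "A \<subseteq> J" "finite A" "J \<subseteq> ideal_gen S A"
    using fg unfolding ideals_fin_gen_def by meson
  have push: "\<phi> p \<in> ideal_gen (\<phi> ` S) (\<phi> ` A)" if "p \<in> ideal_gen S A" for p
    using that by (induction p rule: ideal_gen.induct)
      (auto simp: \<phi>.hom_add \<phi>.hom_mult intro: ideal_gen.intros)
  have "I \<subseteq> ideal_gen (\<phi> ` S) (\<phi> ` A)"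
  proof
    fix x assume "x \<in> I"
    then obtain p where "x = \<phi> p" "p \<in> S" using I unfolding ideal_of_def by auto
    then show "x \<in> ideal_gen (\<phi> ` S) (\<phi> ` A)" using push A \<open>x \<in> I\<close> unfolding J_def by auto
  qed
  moreover have "\<phi> ` A \<subseteq> I" using A unfolding J_def by auto
  ultimately show "\<exists>A\<subseteq>I. finite A \<and> I \<subseteq> ideal_gen (\<phi> ` S) A" using A(2) by blast
qed

lemma coeff_polys_subring:
  assumes "subring_set S"
  shows "subring_set {p. \<forall>i. coeff p i \<in> S}"
proof -
  have "0 \<in> S" "1 \<in> S" "\<And>p q. p \<in> S \<Longrightarrow> q \<in> S \<Longrightarrow> p + q \<in> S" "\<And>p q. p \<in> S \<Longrightarrow> q \<in> S \<Longrightarrow> p * q \<in> S"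
    "\<And>p. p \<in> S \<Longrightarrow> - p \<in> S"
    using assms unfolding subring_set_def by auto
  then show ?thesis
    unfolding subring_set_def
    by (auto simp: coeff_mult intro!: sum_closed_under_add[where P = "\<lambda>x. x \<in> S"] split: if_splits)
qed

text \<open>Hilbert's basis theorem. For an ideal \<open>J\<close> of \<open>S[x]\<close> let \<open>L k\<close> be the ideal of the
  coefficients at \<open>x\<^sup>k\<close> of the members of \<open>J\<close> of degree at most \<open>k\<close>. The chain \<open>L\<close> is
  ascending and stationary from some \<open>d\<close> on. Lifts of finite generating sets of
  \<open>L 0, \<dots>, L d\<close> generate \<open>J\<close>, since they allow to cancel leading terms.\<close>

theorem hilbert_basis:
  fixes S :: "'b::comm_ring_1 set"
  assumes S: "subring_set S" and fg: "ideals_fin_gen S"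
  shows "ideals_fin_gen {p. \<forall>i. coeff p i \<in> S}"
  unfolding ideals_fin_gen_def
proof (intro allI impI)
  let ?P = "{p. \<forall>i. coeff p i \<in> S}"
  fix J assume J: "ideal_of ?P J"
  have S0: "0 \<in> S" "1 \<in> S" and Sadd: "\<And>p q. p \<in> S \<Longrightarrow> q \<in> S \<Longrightarrow> p + q \<in> S"
    and Smult: "\<And>p q. p \<in> S \<Longrightarrow> q \<in> S \<Longrightarrow> p * q \<in> S"
    and Sneg: "\<And>p. p \<in> S \<Longrightarrow> - p \<in> S"
    using S unfolding subring_set_def by auto
  have monom: "monom s k \<in> ?P" if "s \<in> S" for s k
    using that S0 by (auto simp: coeff_monom)
  have P: "subring_set ?P" by (rule coeff_polys_subring[OF S])
  have JP: "J \<subseteq> ?P" and J0: "0 \<in> J" and Jadd: "\<And>p q. p \<in> J \<Longrightarrow> q \<in> J \<Longrightarrow> p + q \<in> J"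
    and Jmult: "\<And>s p. s \<in> ?P \<Longrightarrow> p \<in> J \<Longrightarrow> s * p \<in> J"
    using J unfolding ideal_of_def by blast+
  define L where "L k = {coeff p k |p. p \<in> J \<and> degree p \<le> k}" for k
  have LI: "coeff p k \<in> L k" if "p \<in> J" "degree p \<le> k" for p k
    using that unfolding L_def by blast
  have LE: "\<exists>p\<in>J. degree p \<le> k \<and> coeff p k = c" if "c \<in> L k" for c k
    using that unfolding L_def by blast
  have L_ideal: "ideal_of S (L k)" for k
    unfolding ideal_of_def
  proof (intro conjI ballI subsetI)
    show "c \<in> S" if "c \<in> L k" for c using that JP unfolding L_def by auto
    show "0 \<in> L k" using LI[OF J0, of k] by simp
    fix c assume "c \<in> L k"
    then obtain p where p: "p \<in> J" "degree p \<le> k" "coeff p k = c" using LE by blast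
    show "c + c' \<in> L k" if c': "c' \<in> L k" for c'
    proof -
      obtain q where q: "q \<in> J" "degree q \<le> k" "coeff q k = c'" using LE[OF c'] by blast
      show ?thesis using LI[OF Jadd[OF p(1) q(1)], of k] p q by (simp add: degree_add_le)
    qed
    show "s * c \<in> L k" if s: "s \<in> S" for s
    proof -
      have "degree (monom s 0 * p) \<le> k"
        using p degree_mult_le[of "monom s 0" p] degree_monom_le[of s 0] by simp
      then show ?thesis using LI[OF Jmult[OF monom[OF s, of 0] p(1)], of k] p
        by (simp add: monom_0)
    qed
  qed
  have L_Suc: "L k \<subseteq> L (k + j)" for k j
  proof
    fix c assume "c \<in> L k"
    then obtain p where p: "p \<in> J" "degree p \<le> k" "coeff p k = c" using LE by blast
    have "degree (monom 1 j * p) \<le> k + j"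
      using p degree_mult_le[of "monom 1 j" p] degree_monom_le[of "1::'b" j] by simp
    then show "c \<in> L (k + j)" using LI[OF Jmult[OF monom[OF S0(2), of j] p(1)], of "k + j"] p
      by (simp add: coeff_monom_mult)
  qed
  have L_mono: "L k \<subseteq> L l" if "k \<le> l" for k l
    using L_Suc[of k "l - k"] that by simp
  have "ideal_of S (\<Union>k. L k)"
    unfolding ideal_of_def
  proof (intro conjI ballI subsetI)
    show "c \<in> S" if "c \<in> (\<Union>k. L k)" for c using that L_ideal unfolding ideal_of_def by blast
    show "0 \<in> (\<Union>k. L k)" using LI[OF J0, of 0] by auto
    fix c assume "c \<in> (\<Union>k. L k)"
    then obtain k where k: "c \<in> L k" by blast
    show "s * c \<in> (\<Union>k. L k)" if "s \<in> S" for s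
      using L_ideal[of k] k that unfolding ideal_of_def by blast
    show "c + c' \<in> (\<Union>k. L k)" if c': "c' \<in> (\<Union>k. L k)" for c'
    proof -
      obtain l where l: "c' \<in> L l" using c' by blast
      have "c \<in> L (max k l)" "c' \<in> L (max k l)"
        using k l L_mono[of k "max k l"] L_mono[of l "max k l"] by auto
      then show ?thesis using L_ideal[of "max k l"] unfolding ideal_of_def by blast
    qed
  qed
  then obtain A where A: "A \<subseteq> (\<Union>k. L k)" "finite A" "(\<Union>k. L k) \<subseteq> ideal_gen S A"
    using fg unfolding ideals_fin_gen_def by meson
  have "\<exists>d. A \<subseteq> L d"
    using A(2,1)
  proof (induction A rule: finite_induct)
    case (insert c A)
    then obtain d k where "A \<subseteq> L d" "c \<in> L k" by auto
    then have "insert c A \<subseteq> L (max d k)"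
      using L_mono[of d "max d k"] L_mono[of k "max d k"] by auto
    then show ?case ..
  qed simp
  then obtain d where d: "A \<subseteq> L d" ..
  have L_stat: "L k \<subseteq> L (min k d)" for k
  proof (cases "k \<le> d")
    case False
    then show ?thesis
      using A(3) ideal_gen_minimal[OF _ L_ideal d] by (auto simp: min_def)
  qed (simp add: min_def)
  have "\<exists>A. A \<subseteq> L k \<and> finite A \<and> L k \<subseteq> ideal_gen S A" for k
    using fg L_ideal[of k] unfolding ideals_fin_gen_def by meson
  then obtain B where B: "\<And>k. B k \<subseteq> L k" "\<And>k. finite (B k)" "\<And>k. L k \<subseteq> ideal_gen S (B k)"
    by metis
  have "\<forall>k c. \<exists>p. c \<in> L k \<longrightarrow> p \<in> J \<and> degree p \<le> k \<and> coeff p k = c"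
    using LE by blast
  then obtain f where f: "\<And>k c. c \<in> L k \<Longrightarrow> f k c \<in> J \<and> degree (f k c) \<le> k \<and> coeff (f k c) k = c"
    by metis
  define C where "C = (\<Union>k\<in>{..d}. f k ` B k)"
  have lift: "\<exists>q\<in>ideal_gen ?P C. q \<in> J \<and> degree q \<le> k \<and> coeff q k = c" if "k \<le> d" "c \<in> ideal_gen S (B k)" for k c
    using that(2)
  proof (induction c rule: ideal_gen.induct)
    case zero
    show ?case using ideal_gen.zero J0 by force
  next
    case (add s b c)
    then obtain q where q: "q \<in> ideal_gen ?P C" "q \<in> J" "degree q \<le> k" "coeff q k = c" by blast
    have fb: "f k b \<in> J" "degree (f k b) \<le> k" "coeff (f k b) k = b" "f k b \<in> C"
      using f[of b k] B(1)[of k] add \<open>k \<le> d\<close> unfolding C_def by auto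
    let ?q = "monom s 0 * f k b + q"
    have "degree (monom s 0 * f k b) \<le> k"
      using fb degree_mult_le[of "monom s 0" "f k b"] degree_monom_le[of s 0] by simp
    moreover have "?q \<in> ideal_gen ?P C"
      by (rule ideal_gen.add[OF monom[OF add(1)] fb(4) q(1)])
    moreover have "?q \<in> J" by (rule Jadd[OF Jmult[OF monom[OF add(1)] fb(1)] q(2)])
    ultimately show ?case using q fb
      by (intro bexI[of _ ?q]) (auto simp: degree_add_le monom_0)
  qed
  have gen: "p \<in> ideal_gen ?P C" if "p \<in> J" "degree p \<le> k" for p k
    using that
  proof (induction k arbitrary: p rule: less_induct)
    case (less k)
    let ?l = "min k d"
    have "coeff p k \<in> L ?l" using L_stat LI[OF less.prems] by blast
    then obtain q where q: "q \<in> ideal_gen ?P C" "q \<in> J" "degree q \<le> ?l" "coeff q ?l = coeff p k"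
      using lift[of ?l "coeff p k"] B(3)[of ?l] by auto
    let ?m = "monom 1 (k - ?l)"
    let ?r = "p + monom (-1) (k - ?l) * q"
    have m: "?m \<in> ?P" and m': "monom (-1) (k - ?l) \<in> ?P" using monom S0 Sneg by auto
    have "coeff ?r k = 0" using q by (simp add: coeff_monom_mult)
    have "degree (monom (-1) (k - ?l) * q) \<le> k"
      using q degree_mult_le[of "monom (-1) (k - ?l)" q] degree_monom_le[of "-1::'b" "k - ?l"]
      by (simp add: min_def split: if_splits)
    then have "degree ?r \<le> k" using less.prems by (simp add: degree_add_le)
    have "?r \<in> J" by (rule Jadd[OF less.prems(1) Jmult[OF m' q(2)]])
    have "?r \<in> ideal_gen ?P C"
    proof (cases k)
      case 0
      then have "?r = 0" using \<open>coeff ?r k = 0\<close> \<open>degree ?r \<le> k\<close> by (metis le_zero_eq leading_coeff_0_iff)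
      then show ?thesis using ideal_gen.zero by metis
    next
      case (Suc k')
      then have "degree ?r \<le> k'"
        using \<open>coeff ?r k = 0\<close> \<open>degree ?r \<le> k\<close> by (metis coeff_0 degree_0 le_Suc_eq leading_coeff_0_iff zero_le)
      then show ?thesis using less.IH[of k' ?r] Suc \<open>?r \<in> J\<close> by simp
    qed
    moreover have "?m * q \<in> ideal_gen ?P C" by (rule ideal_gen_mult[OF P m q(1)])
    ultimately have "?r + ?m * q \<in> ideal_gen ?P C" by (rule ideal_gen_add)
    moreover have "?r + ?m * q = p" by (simp add: minus_monom[symmetric])
    ultimately show ?case by simp
  qed
  have "C \<subseteq> J" using f B(1) unfolding C_def by blast
  moreover have "finite C" using B(2) unfolding C_def by blast
  ultimately show "\<exists>A\<subseteq>J. finite A \<and> J \<subseteq> ideal_gen ?P A" using gen by blast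
qed

lemma constants_fin_gen: "ideals_fin_gen (range (const_mp :: 'a::field \<Rightarrow> 'a mpoly))"
  unfolding ideals_fin_gen_def
proof (intro allI impI)
  interpret c: comm_ring_hom "const_mp :: 'a \<Rightarrow> 'a mpoly" by (rule const_mp_hom)
  fix I assume I: "ideal_of (range (const_mp :: 'a \<Rightarrow> _)) I"
  show "\<exists>A\<subseteq>I. finite A \<and> I \<subseteq> ideal_gen (range const_mp) A"
  proof (cases "I = {0}")
    case True
    then show ?thesis by (intro exI[of _ "{}"]) (auto intro: ideal_gen.zero)
  next
    case False
    then obtain a where a: "const_mp a \<in> I" "a \<noteq> 0"
      using I unfolding ideal_of_def by force
    have "x \<in> ideal_gen (range const_mp) {const_mp a}" if x: "x \<in> I" for x
    proof -
      obtain b where "x = const_mp b" using I x unfolding ideal_of_def by auto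
      then have "x = const_mp (b / a) * const_mp a + 0" using a by (simp flip: c.hom_mult)
      then show ?thesis by (metis ideal_gen.intros insertI1 rangeI)
    qed
    then show ?thesis using a by (intro exI[of _ "{const_mp a}"]) auto
  qed
qed

text \<open>Adjoining a variable is a surjective homomorphism from univariate polynomials over the
  smaller ring. In this form Hilbert's theorem transfers.\<close>

lemma vars_mp_insert_eq_image:
  "{p :: 'a::comm_ring_1 mpoly. vars_mp p \<subseteq> insert v V}
     = (\<lambda>q. poly q (var_mp v)) ` {q. \<forall>i. coeff q i \<in> {p. vars_mp p \<subseteq> V}}"
  (is "?L = ?\<phi> ` ?Q")
proof
  have sub: "subring_set {p :: 'a mpoly. vars_mp p \<subseteq> W}" for W by (rule vars_mp_subring)
  show "?\<phi> ` ?Q \<subseteq> ?L"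
  proof
    fix p assume "p \<in> ?\<phi> ` ?Q"
    then obtain q where q: "\<And>i. vars_mp (coeff q i) \<subseteq> V" and p: "p = poly q (var_mp v)" by auto
    have "vars_mp (coeff q i * var_mp v ^ i) \<subseteq> insert v V" for i
    proof -
      have "vars_mp ((var_mp v :: 'a mpoly) ^ i) \<subseteq> insert v V"
      proof (induction i)
        case (Suc i)
        then show ?case using vars_mp_mult[of "var_mp v :: 'a mpoly" "var_mp v ^ i"] by auto
      qed (simp add: vars_mp_def)
      then show ?thesis using vars_mp_mult[of "coeff q i" "var_mp v ^ i"] q[of i] by auto
    qed
    moreover have "p + q \<in> ?L" if "p \<in> ?L" "q \<in> ?L" for p q
      using that sub[of "insert v V"] unfolding subring_set_def by blast
    ultimately have "(\<Sum>i\<le>degree q. coeff q i * var_mp v ^ i) \<in> ?L"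
      by (intro sum_closed_under_add[where P = "\<lambda>x. x \<in> ?L"]) (auto simp: vars_mp_def)
    then show "p \<in> ?L" unfolding p poly_altdef .
  qed
  have S: "subring_set {p :: 'a mpoly. vars_mp p \<subseteq> V}" by (rule sub)
  have img_add: "x + y \<in> ?\<phi> ` ?Q" if xy: "x \<in> ?\<phi> ` ?Q" "y \<in> ?\<phi> ` ?Q" for x y
  proof -
    obtain q r where qr: "q \<in> ?Q" "r \<in> ?Q" "x = poly q (var_mp v)" "y = poly r (var_mp v)" using xy by auto
    have "q + r \<in> ?Q" using qr S unfolding subring_set_def by auto
    then show ?thesis using qr by (intro image_eqI[of _ _ "q + r"]) auto
  qed
  have img_mult: "x * y \<in> ?\<phi> ` ?Q" if xy: "x \<in> ?\<phi> ` ?Q" "y \<in> ?\<phi> ` ?Q" for x y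
  proof -
    obtain q r where qr: "q \<in> ?Q" "r \<in> ?Q" "x = poly q (var_mp v)" "y = poly r (var_mp v)" using xy by auto
    have "q * r \<in> ?Q" using qr coeff_polys_subring[OF S] unfolding subring_set_def by blast
    then show ?thesis using qr by (intro image_eqI[of _ _ "q * r"]) auto
  qed
  show "?L \<subseteq> ?\<phi> ` ?Q"
  proof
    fix p :: "'a mpoly" assume "p \<in> ?L"
    then have "vars_mp p \<subseteq> insert v V" by simp
    then show "p \<in> ?\<phi> ` ?Q"
    proof (induction p rule: mpoly_induct)
      case (const c)
      have "[:const_mp c:] \<in> ?Q" by (auto simp: coeff_pCons vars_mp_def[of 0] split: nat.splits)
      then show ?case by (intro image_eqI[of _ _ "[:const_mp c:]"]) auto
    next
      case (var w)
      show ?case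
      proof (cases "w = v")
        case True
        have "[:0, 1:] \<in> ?Q" by (auto simp: coeff_pCons vars_mp_def[of 0] vars_mp_def[of 1] split: nat.splits)
        then show ?thesis using True by (intro image_eqI[of _ _ "[:0, 1:]"]) auto
      next
        case False
        then have "[:var_mp w:] \<in> ?Q" using var by (auto simp: coeff_pCons vars_mp_def[of 0] split: nat.splits)
        then show ?thesis by (intro image_eqI[of _ _ "[:var_mp w:]"]) auto
      qed
    next
      case (add p q)
      then show ?case by (rule img_add)
    next
      case (mult p q)
      then show ?case by (rule img_mult)
    qed
  qed
qed

lemma polynomials_fin_gen:
  assumes "finite V"
  shows "ideals_fin_gen {p :: 'a::field mpoly. vars_mp p \<subseteq> V}"
  using assms
proof (induction V rule: finite_induct)
  case empty
  interpret c: comm_ring_hom "const_mp :: 'a \<Rightarrow> 'a mpoly" by (rule const_mp_hom)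
  have "{p :: 'a mpoly. vars_mp p \<subseteq> {}} = range const_mp"
  proof (intro equalityI subsetI)
    fix p :: "'a mpoly" assume "p \<in> {p. vars_mp p \<subseteq> {}}"
    then have "vars_mp p \<subseteq> {}" by simp
    then show "p \<in> range const_mp"
    proof (induction p rule: mpoly_induct)
      case (add p q)
      then show ?case by (auto simp flip: c.hom_add)
    next
      case (mult p q)
      then show ?case by (auto simp flip: c.hom_mult)
    qed auto
  qed auto
  then show ?case using constants_fin_gen by simp
next
  case (insert v V)
  have "comm_ring_hom (\<lambda>q. poly q (var_mp v :: 'a mpoly))"
    by unfold_locales simp_all
  from ideals_fin_gen_image[OF coeff_polys_subring[OF vars_mp_subring]
      hilbert_basis[OF vars_mp_subring insert.IH] this]
  show ?case by (simp only: vars_mp_insert_eq_image)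
qed

lemma poly_ring_simps [simp]:
  "carrier (poly_ring n) = {p. vars_mp p \<subseteq> set (xvars n)}"
  "p \<otimes>\<^bsub>poly_ring n\<^esub> q = p * q" "\<one>\<^bsub>poly_ring n\<^esub> = 1"
  "\<zero>\<^bsub>poly_ring n\<^esub> = 0" "p \<oplus>\<^bsub>poly_ring n\<^esub> q = p + q"
  by (simp_all add: poly_ring_def)

lemma poly_ring_cring: "cring (poly_ring n :: 'a::comm_ring_1 mpoly ring)"
proof (rule cringI)
  have S: "subring_set {p :: 'a mpoly. vars_mp p \<subseteq> set (xvars n)}" by (rule vars_mp_subring)
  show "abelian_group (poly_ring n :: 'a mpoly ring)"
  proof (rule abelian_groupI)
    fix p :: "'a mpoly" assume "p \<in> carrier (poly_ring n)"
    then show "\<exists>q\<in>carrier (poly_ring n). q \<oplus>\<^bsub>poly_ring n\<^esub> p = \<zero>\<^bsub>poly_ring n\<^esub>"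
      by (intro bexI[of _ "- p"]) simp_all
  qed (use S in \<open>auto simp: subring_set_def add_ac\<close>)
  show "comm_monoid (poly_ring n :: 'a mpoly ring)"
    using S by (intro comm_monoidI) (auto simp: subring_set_def mult_ac)
qed (simp add: distrib_right)

lemma xvars_set: "set (xvars n) = Xv ` {1..n}"
  by (auto simp: xvars_def)

lemma poly_ring_pow: "p [^]\<^bsub>poly_ring n\<^esub> (k::nat) = (p ^ k :: 'a::comm_ring_1 mpoly)"
  by (induction k) (simp_all add: nat_pow_def mult.commute)

lemma var_in_poly_ring:
  assumes "i \<in> {1..n}"
  shows "var_mp (Xv i) \<in> carrier (poly_ring n :: 'a::comm_ring_1 mpoly ring)"
  using assms by (simp add: xvars_set)

lemma const_in_poly_ring: "const_mp c \<in> carrier (poly_ring n)"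
  by simp

lemma ideal_poly_ring_iff:
  "ideal I (poly_ring n :: 'a::comm_ring_1 mpoly ring) \<longleftrightarrow> ideal_of (carrier (poly_ring n)) I"
proof
  assume "ideal I (poly_ring n :: 'a mpoly ring)"
  then interpret I: ideal I "poly_ring n :: 'a mpoly ring" .
  show "ideal_of (carrier (poly_ring n)) I"
    unfolding ideal_of_def
    using I.Icarr additive_subgroup.zero_closed[OF ideal.axioms(1)[OF I.ideal_axioms]]
      additive_subgroup.a_closed[OF ideal.axioms(1)[OF I.ideal_axioms]] I.I_l_closed by auto
next
  interpret R: cring "poly_ring n :: 'a mpoly ring" by (rule poly_ring_cring)
  assume I: "ideal_of (carrier (poly_ring n)) I"
  have neg: "\<ominus>\<^bsub>poly_ring n\<^esub> p = - p" if "p \<in> carrier (poly_ring n)" for p :: "'a mpoly"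
    using that by (intro R.minus_equality) simp_all
  have "- p \<in> I" if "p \<in> I" for p
  proof -
    have "- 1 \<in> carrier (poly_ring n :: 'a mpoly ring)" by (simp add: vars_mp_def)
    then have "- 1 * p \<in> I" using I that unfolding ideal_of_def by blast
    then show ?thesis by simp
  qed
  moreover have sub: "I \<subseteq> carrier (poly_ring n)" "0 \<in> I" using I unfolding ideal_of_def by blast+
  ultimately have inv: "\<ominus>\<^bsub>poly_ring n\<^esub> p \<in> I" if "p \<in> I" for p using that neg by auto
  have mult: "s * p \<in> I" if "p \<in> I" "s \<in> carrier (poly_ring n)" for s p
    using I that unfolding ideal_of_def by blast
  have "subgroup I (add_monoid (poly_ring n :: 'a mpoly ring))"
  proof (rule R.add.subgroupI)
    show "I \<noteq> {}" using sub by blast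
    show "p \<oplus>\<^bsub>poly_ring n\<^esub> q \<in> I" if "p \<in> I" "q \<in> I" for p q
      using I that unfolding ideal_of_def by simp
  qed (use sub inv in simp_all)
  then show "ideal I (poly_ring n :: 'a mpoly ring)"
    using mult by (intro idealI R.ring_axioms) (simp_all add: mult.commute)
qed

lemma poly_ring_noetherian: "noetherian_ring (poly_ring n :: 'a::field mpoly ring)"
proof -
  let ?R = "poly_ring n :: 'a mpoly ring"
  interpret R: cring ?R by (rule poly_ring_cring)
  have "\<exists>A\<subseteq>carrier ?R. finite A \<and> I = Idl\<^bsub>?R\<^esub> A" if I: "ideal I ?R" for I
  proof -
    have I': "ideal_of (carrier ?R) I" using I by (simp only: ideal_poly_ring_iff)
    then obtain A where A: "A \<subseteq> I" "finite A" "I \<subseteq> ideal_gen (carrier ?R) A"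
      using polynomials_fin_gen[of "set (xvars n)"] unfolding ideals_fin_gen_def by auto
    have Ac: "A \<subseteq> carrier ?R" using A(1) I' unfolding ideal_of_def by blast
    have "ideal_of (carrier ?R) (Idl\<^bsub>?R\<^esub> A)"
      using R.genideal_ideal[OF Ac] by (simp only: ideal_poly_ring_iff)
    then have "I \<subseteq> Idl\<^bsub>?R\<^esub> A"
      using A(3) ideal_gen_minimal R.genideal_self[OF Ac] by blast
    moreover have "Idl\<^bsub>?R\<^esub> A \<subseteq> I" by (rule R.genideal_minimal[OF I A(1)])
    ultimately show ?thesis using A Ac by blast
  qed
  then show ?thesis by (rule R.noetherian_ringI)
qed

section \<open>Multiplicity along a smooth curve\<close>

text \<open>Modulo \<open>t\<^sup>\<mu>\<close> a polynomial with nonzero constant coefficient is a unit.\<close>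

lemma monom_dvd_cancel:
  fixes a b :: "'a::field poly"
  assumes "monom 1 \<mu> dvd a * b" and "poly b 0 \<noteq> 0"
  shows "monom 1 \<mu> dvd a"
proof -
  have "coeff a m = 0" if "m < \<mu>" for m
    using that
  proof (induction m rule: less_induct)
    case (less m)
    have "coeff (a * b) m = (\<Sum>i\<le>m. coeff a i * coeff b (m - i))" by (rule coeff_mult)
    also have "\<dots> = (\<Sum>i\<in>{m}. coeff a i * coeff b (m - i))"
      using less by (intro sum.mono_neutral_right) auto
    finally have "coeff a m * coeff b 0 = 0"
      using assms(1) less.prems by (simp add: monom_1_dvd_iff')
    then show ?case using assms(2) by (simp add: poly_0_coeff_0)
  qed
  then show ?thesis by (simp add: monom_1_dvd_iff')
qed

text \<open>A curve through the point \<open>x\<close>, parametrized by \<open>t = x\<^sub>1 - x 1\<close>: \<open>X i\<close> is its \<open>i\<close>-th coordinate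
  as a polynomial in \<open>t\<close>.\<close>

locale curve =
  fixes x :: "nat \<Rightarrow> 'a::field" and X :: "nat \<Rightarrow> 'a poly"
  assumes X_1: "X 1 = [:x 1, 1:]" and X_0: "\<And>i. poly (X i) 0 = x i"
begin

definition on_curve :: "'a mpoly \<Rightarrow> 'a poly" where
  "on_curve = insertion_mp (\<lambda>c. [:c:]) (\<lambda>v. case v of Xv i \<Rightarrow> X i | _ \<Rightarrow> 0)"

text \<open>Replaces \<open>t\<close> by \<open>x\<^sub>1 - x 1\<close>, which makes it a right inverse of \<open>on_curve\<close>.\<close>

definition in_x1 :: "'a poly \<Rightarrow> 'a mpoly" where
  "in_x1 r = poly (map_poly const_mp r) (var_mp (Xv 1) - const_mp (x 1))"

definition offset :: "nat \<Rightarrow> 'a mpoly" where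
  "offset j = var_mp (Xv j) - in_x1 (X j)"

abbreviation ev :: "'a mpoly \<Rightarrow> 'a" where "ev \<equiv> eval_mp (x_point x)"

sublocale on: comm_ring_hom on_curve
  unfolding on_curve_def by (rule insertion_mp_hom[OF constant_poly_hom])

sublocale ev: comm_ring_hom ev
  by (rule eval_mp_hom)

sublocale ix: comm_ring_hom in_x1
  unfolding in_x1_def by (rule comm_ring_hom_comp[OF poly_hom map_poly_hom[OF const_mp_hom]])

lemma on_curve_const [simp]: "on_curve (const_mp c) = [:c:]"
  by (simp add: on_curve_def)

lemma on_curve_var [simp]: "on_curve (var_mp (Xv i)) = X i"
  by (simp add: on_curve_def constant_poly_hom)

lemma ev_var [simp]: "ev (var_mp (Xv i)) = x i"
  by (simp add: id_hom x_point_def)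

lemma on_curve_at_0: "poly (on_curve p) 0 = ev p"
proof (rule ring_hom_eq_on_mpoly[where V = UNIV])
  show "comm_ring_hom (\<lambda>p. poly (on_curve p) 0)"
    by (rule comm_ring_hom_comp[OF poly_hom on.comm_ring_hom_axioms])
  show "poly (on_curve (var_mp v)) 0 = ev (var_mp v)" for v
    by (cases v) (simp_all add: on_curve_def constant_poly_hom id_hom x_point_def X_0)
qed (simp_all add: eval_mp_hom)

lemma in_x1_pCons: "in_x1 (pCons c r) = const_mp c + (var_mp (Xv 1) - const_mp (x 1)) * in_x1 r"
  by (simp add: in_x1_def map_poly_pCons)

lemma in_x1_const [simp]: "in_x1 [:c:] = const_mp c"
  by (simp add: in_x1_pCons)

lemma on_curve_in_x1 [simp]: "on_curve (in_x1 r) = r"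
  by (induction r) (simp_all add: in_x1_pCons on.hom_add on.hom_mult on.hom_minus X_1[simplified])

lemma ev_in_x1 [simp]: "ev (in_x1 r) = poly r 0"
  by (simp flip: on_curve_at_0)

lemma on_curve_offset [simp]: "on_curve (offset j) = 0"
  by (simp add: offset_def on.hom_minus)

lemma ev_offset [simp]: "ev (offset j) = 0"
  by (simp flip: on_curve_at_0)

text \<open>In the coordinates \<open>x\<^sub>1\<close> and \<open>offset j\<close> the curve is the axis where all offsets vanish, so the
  part of \<open>p\<close> that is free of the offsets is its restriction to the curve. The coefficients \<open>M j\<close>
  follow the product rule up to multiples of the offsets; hence their values at the point are
  partial derivatives.\<close>

lemma expansion_along_curve:
  assumes "vars_mp p \<subseteq> Xv ` {1..n}"
  shows "\<exists>M. p = in_x1 (on_curve p) + (\<Sum>j=2..n. M j * offset j) \<and>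
             (\<forall>j\<in>{2..n}. ev (M j) = ev (pdiff (Xv j) p))"
  using assms
proof (induction p rule: mpoly_induct)
  case (const c)
  show ?case by (intro exI[of _ "\<lambda>_. 0"]) simp
next
  case (var v)
  then obtain i where v: "v = Xv i" and i: "i \<in> {1..n}" by blast
  show ?case
  proof (cases "i = 1")
    case True
    then show ?thesis using v
      by (intro exI[of _ "\<lambda>_. 0"]) (simp add: X_1[simplified] in_x1_pCons pdiff_var)
  next
    case False
    then have "i \<in> {2..n}" using i by auto
    then have "(\<Sum>j=2..n. (if j = i then 1 else 0) * offset j) = offset i"
      by (simp add: if_distrib[of "\<lambda>c. c * _"] cong: if_cong)
    then show ?thesis using v
      by (intro exI[of _ "\<lambda>j. if j = i then 1 else 0"]) (auto simp: pdiff_var offset_def)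
  qed
next
  case (add p q)
  then obtain M N where
    M: "p = in_x1 (on_curve p) + (\<Sum>j=2..n. M j * offset j)" "\<forall>j\<in>{2..n}. ev (M j) = ev (pdiff (Xv j) p)" and
    N: "q = in_x1 (on_curve q) + (\<Sum>j=2..n. N j * offset j)" "\<forall>j\<in>{2..n}. ev (N j) = ev (pdiff (Xv j) q)"
    by blast
  have "p + q = in_x1 (on_curve p) + in_x1 (on_curve q) + (\<Sum>j=2..n. (M j + N j) * offset j)"
    by (subst M(1), subst N(1)) (simp add: distrib_right sum.distrib)
  then have "p + q = in_x1 (on_curve (p + q)) + (\<Sum>j=2..n. (M j + N j) * offset j)"
    unfolding on.hom_add ix.hom_add .
  moreover have "\<forall>j\<in>{2..n}. ev (M j + N j) = ev (pdiff (Xv j) (p + q))"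
    using M(2) N(2) by (simp add: ev.hom_add pdiff_add)
  ultimately show ?case by (intro exI[of _ "\<lambda>j. M j + N j"]) simp
next
  case (mult p q)
  then obtain M N where
    M: "p = in_x1 (on_curve p) + (\<Sum>j=2..n. M j * offset j)" "\<forall>j\<in>{2..n}. ev (M j) = ev (pdiff (Xv j) p)" and
    N: "q = in_x1 (on_curve q) + (\<Sum>j=2..n. N j * offset j)" "\<forall>j\<in>{2..n}. ev (N j) = ev (pdiff (Xv j) q)"
    by blast
  have "p * q = in_x1 (on_curve p) * q + (\<Sum>j=2..n. M j * offset j) * q"
    by (subst M(1)) (simp add: distrib_right)
  also have "in_x1 (on_curve p) * q
      = in_x1 (on_curve p) * in_x1 (on_curve q) + in_x1 (on_curve p) * (\<Sum>j=2..n. N j * offset j)"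
    by (subst N(1)) (simp add: distrib_left)
  finally have "p * q = in_x1 (on_curve p) * in_x1 (on_curve q)
      + (\<Sum>j=2..n. (in_x1 (on_curve p) * N j + M j * q) * offset j)"
    by (simp add: sum_distrib_left sum_distrib_right sum.distrib algebra_simps)
  then have "p * q = in_x1 (on_curve (p * q)) + (\<Sum>j=2..n. (in_x1 (on_curve p) * N j + M j * q) * offset j)"
    unfolding on.hom_mult ix.hom_mult .
  moreover have "\<forall>j\<in>{2..n}. ev (in_x1 (on_curve p) * N j + M j * q) = ev (pdiff (Xv j) (p * q))"
    using M(2) N(2) by (simp add: ev.hom_add ev.hom_mult pdiff_mult on_curve_at_0 add.commute)
  ultimately show ?case by (intro exI[of _ "\<lambda>j. in_x1 (on_curve p) * N j + M j * q"]) simp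
qed

text \<open>The kernel of the restriction to the curve modulo \<open>t\<^sup>\<mu>\<close>. It is going to be the primary
  component at \<open>x\<close> of a system that vanishes to order \<open>\<mu>\<close> along the curve.\<close>

definition contact_ideal :: "nat \<Rightarrow> nat \<Rightarrow> 'a mpoly set" where
  "contact_ideal n \<mu> = {p \<in> carrier (poly_ring n). monom 1 \<mu> dvd on_curve p}"

lemma contact_ideal_ideal: "ideal (contact_ideal n \<mu>) (poly_ring n)"
  unfolding ideal_poly_ring_iff ideal_of_def contact_ideal_def
  using vars_mp_subring[of "set (xvars n)"]
  by (auto simp: subring_set_def on.hom_add on.hom_mult)

text \<open>If \<open>p\<close> vanishes at the point, then \<open>t\<close> divides its restriction to the curve and \<open>t\<^sup>\<mu>\<close> divides
  the restriction of \<open>p\<^sup>\<mu>\<close>.\<close>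

lemma radical_contact_ideal:
  assumes "\<mu> \<ge> 1"
  shows "radical (poly_ring n) (contact_ideal n \<mu>) = {p \<in> carrier (poly_ring n). ev p = 0}"
proof (intro equalityI subsetI)
  fix p assume "p \<in> radical (poly_ring n) (contact_ideal n \<mu>)"
  then obtain k where p: "p \<in> carrier (poly_ring n)" and k: "monom 1 \<mu> dvd on_curve p ^ k"
    unfolding radical_def contact_ideal_def poly_ring_pow by (auto simp: on.hom_power)
  then have "coeff (on_curve p ^ k) 0 = 0" using assms by (simp add: monom_1_dvd_iff')
  then have "poly (on_curve p) 0 ^ k = 0" by (simp add: poly_0_coeff_0[symmetric] poly_power)
  then show "p \<in> {p \<in> carrier (poly_ring n). ev p = 0}" using p by (simp add: on_curve_at_0)
next
  fix p assume p: "p \<in> {p \<in> carrier (poly_ring n). ev p = 0}"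
  then have "poly (on_curve p) 0 = 0" by (simp add: on_curve_at_0)
  then have "[:0, 1:] dvd on_curve p" by (simp add: poly_eq_0_iff_dvd)
  then have "monom 1 \<mu> dvd on_curve p ^ \<mu>" by (simp add: monom_altdef dvd_power_same)
  moreover interpret cring "poly_ring n :: 'a mpoly ring" by (rule poly_ring_cring)
  have "p [^]\<^bsub>poly_ring n\<^esub> \<mu> \<in> carrier (poly_ring n)" using p by (intro nat_pow_closed) simp
  ultimately have "p [^]\<^bsub>poly_ring n\<^esub> \<mu> \<in> contact_ideal n \<mu>"
    by (simp add: contact_ideal_def poly_ring_pow on.hom_power)
  then show "p \<in> radical (poly_ring n) (contact_ideal n \<mu>)"
    using p unfolding radical_def by blast
qed

lemma contact_ideal_primary:
  assumes "\<mu> \<ge> 1"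
  shows "primary_ideal (poly_ring n) (contact_ideal n \<mu>)"
proof -
  have "1 \<notin> contact_ideal n \<mu>" using assms by (simp add: contact_ideal_def monom_1_dvd_iff')
  moreover have "1 \<in> carrier (poly_ring n :: 'a mpoly ring)" by (simp add: vars_mp_def)
  ultimately have "contact_ideal n \<mu> \<noteq> carrier (poly_ring n)" by blast
  moreover have "p \<in> contact_ideal n \<mu> \<or> q \<in> radical (poly_ring n) (contact_ideal n \<mu>)"
    if "p \<in> carrier (poly_ring n)" "q \<in> carrier (poly_ring n)" "p * q \<in> contact_ideal n \<mu>" for p q
    using that monom_dvd_cancel[of \<mu> "on_curve p" "on_curve q"]
    unfolding radical_contact_ideal[OF assms]
    by (auto simp: contact_ideal_def on.hom_mult on_curve_at_0)
  ultimately show ?thesis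
    using contact_ideal_ideal unfolding primary_ideal_def by simp
qed

text \<open>By induction on \<open>p\<close>, the ideal of the point contains \<open>p - p(x)\<close>.\<close>

lemma point_ideal_eq: "point_ideal n x = {p \<in> carrier (poly_ring n). ev p = 0}"
proof
  let ?R = "poly_ring n :: 'a mpoly ring"
  let ?S = "{var_mp (Xv i) - const_mp (x i) | i. i \<in> {1..n}}"
  interpret R: cring ?R by (rule poly_ring_cring)
  have minus: "p - q \<in> carrier ?R" if "p \<in> carrier ?R" "q \<in> carrier ?R" for p q
    using that vars_mp_add[of p "- q"] by auto
  have S: "?S \<subseteq> carrier ?R"
    by (auto simp del: poly_ring_simps(1) intro!: minus var_in_poly_ring const_in_poly_ring)
  have "ideal {p \<in> carrier ?R. ev p = 0} ?R"
    unfolding ideal_poly_ring_iff ideal_of_def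
    using vars_mp_subring[of "set (xvars n)"]
    by (auto simp: subring_set_def ev.hom_add ev.hom_mult)
  then show "point_ideal n x \<subseteq> {p \<in> carrier ?R. ev p = 0}"
    unfolding point_ideal_def
    by (rule R.genideal_minimal) (use S in \<open>auto simp: ev.hom_minus\<close>)
  have I: "ideal (point_ideal n x) ?R" unfolding point_ideal_def by (rule R.genideal_ideal[OF S])
  have add_closed: "p + q \<in> point_ideal n x" if "p \<in> point_ideal n x" "q \<in> point_ideal n x" for p q
    using I that unfolding ideal_poly_ring_iff ideal_of_def by blast
  have mult_closed: "r * p \<in> point_ideal n x" if "p \<in> point_ideal n x" "r \<in> carrier ?R" for p r
    using I that unfolding ideal_poly_ring_iff ideal_of_def by blast
  have "p \<in> carrier ?R \<and> p - const_mp (ev p) \<in> point_ideal n x" if "vars_mp p \<subseteq> Xv ` {1..n}" for p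
    using that
  proof (induction p rule: mpoly_induct)
    case (const c)
    show ?case using I unfolding ideal_poly_ring_iff ideal_of_def by simp
  next
    case (var v)
    then obtain i where i: "v = Xv i" "i \<in> {1..n}" by blast
    then have "var_mp v - const_mp (x i) \<in> ?S" by blast
    then show ?case using R.genideal_self[OF S] i var_in_poly_ring[of i n]
      unfolding point_ideal_def by auto
  next
    case (add p q)
    have eq: "p + q - const_mp (ev (p + q)) = (p - const_mp (ev p)) + (q - const_mp (ev q))"
      by (simp only: ev.hom_add const_mp_def single_add) simp
    have "(p - const_mp (ev p)) + (q - const_mp (ev q)) \<in> point_ideal n x"
      using add.IH by (intro add_closed) auto
    then show ?case using add.IH R.a_closed[of p q] unfolding eq by simp
  next
    case (mult p q)
    have eq: "p * q - const_mp (ev (p * q)) = q * (p - const_mp (ev p)) + const_mp (ev p) * (q - const_mp (ev q))"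
      by (simp add: ev.hom_mult algebra_simps const_mp_def mult_single)
    have "q * (p - const_mp (ev p)) + const_mp (ev p) * (q - const_mp (ev q)) \<in> point_ideal n x"
      using mult.IH by (intro add_closed mult_closed const_in_poly_ring) auto
    then show ?case using mult.IH R.m_closed[of p q] unfolding eq by simp
  qed
  then show "{p \<in> carrier ?R. ev p = 0} \<subseteq> point_ideal n x"
    by (fastforce simp: xvars_set)
qed

text \<open>Specializing all foreign variables to the coordinates of the point turns an identity between
  arbitrary polynomials into one in \<open>K[x]\<close> without changing any value at the point.\<close>

lemma projection_onto_poly_ring:
  "\<exists>\<pi>. comm_ring_hom \<pi> \<and> (\<forall>p. \<pi> p \<in> carrier (poly_ring n)) \<and>
     (\<forall>p\<in>carrier (poly_ring n). \<pi> p = p) \<and> (\<forall>p. ev (\<pi> p) = ev p)"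
proof (intro exI conjI allI ballI)
  let ?\<pi> = "subst_mp (\<lambda>v. if v \<in> set (xvars n) then var_mp v else const_mp (x_point x v)) :: 'a mpoly \<Rightarrow> _"
  show hom: "comm_ring_hom ?\<pi>" by (rule insertion_mp_hom[OF const_mp_hom])
  interpret \<pi>: comm_ring_hom ?\<pi> by (rule hom)
  have S: "subring_set (carrier (poly_ring n :: 'a mpoly ring))"
    using vars_mp_subring by simp
  fix p :: "'a mpoly"
  have "vars_mp p \<subseteq> UNIV" by simp
  then show "?\<pi> p \<in> carrier (poly_ring n)"
  proof (induction p rule: mpoly_induct)
    case (add p q)
    then show ?case using S unfolding \<pi>.hom_add subring_set_def by blast
  next
    case (mult p q)
    then show ?case using S unfolding \<pi>.hom_mult subring_set_def by blast
  qed (simp_all add: const_mp_hom)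
  show "ev (?\<pi> p) = ev p"
    by (rule ring_hom_eq_on_mpoly[where V = UNIV, OF comm_ring_hom_comp[OF eval_mp_hom hom] eval_mp_hom])
      (simp_all add: const_mp_hom id_hom)
  show "?\<pi> p = p" if "p \<in> carrier (poly_ring n)"
    by (rule ring_hom_eq_on_mpoly[where V = "set (xvars n)", OF hom id_hom])
      (use that in \<open>simp_all add: const_mp_hom\<close>)
qed

text \<open>Generators of the contact ideal, numbered from 0 like the columns of a matrix: \<open>t\<^sup>\<mu>\<close> first, then
  the offsets of the coordinates \<open>2, \<dots>, n\<close>.\<close>

definition contact_gen :: "nat \<Rightarrow> nat \<Rightarrow> 'a mpoly" where
  "contact_gen \<mu> j = (if j = 0 then in_x1 (monom 1 \<mu>) else offset (Suc j))"

lemma contact_expansion: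
  assumes "n \<ge> 1" and "p \<in> contact_ideal n \<mu>"
  shows "\<exists>c. p = (\<Sum>j<n. c j * contact_gen \<mu> j) \<and> ev (c 0) = coeff (on_curve p) \<mu> \<and>
             (\<forall>j\<in>{1..<n}. ev (c j) = ev (pdiff (Xv (Suc j)) p))"
proof -
  have "vars_mp p \<subseteq> Xv ` {1..n}" and "monom 1 \<mu> dvd on_curve p"
    using assms by (auto simp: contact_ideal_def xvars_set)
  from this(2) obtain w where w: "on_curve p = monom 1 \<mu> * w" by (rule dvdE)
  from expansion_along_curve[OF \<open>vars_mp p \<subseteq> _\<close>] obtain M
    where M: "p = in_x1 (on_curve p) + (\<Sum>j=2..n. M j * offset j)" "\<forall>j\<in>{2..n}. ev (M j) = ev (pdiff (Xv j) p)"
    by blast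
  let ?c = "\<lambda>j. if j = 0 then in_x1 w else M (Suc j)"
  have "(\<Sum>j=2..n. M j * offset j) = (\<Sum>j=1..<n. M (Suc j) * offset (Suc j))"
    by (rule sum.reindex_bij_witness[of _ Suc "\<lambda>j. j - 1"]) auto
  also have "\<dots> = (\<Sum>j=1..<n. ?c j * contact_gen \<mu> j)"
    by (rule sum.cong) (auto simp: contact_gen_def)
  finally have "p = ?c 0 * contact_gen \<mu> 0 + (\<Sum>j=1..<n. ?c j * contact_gen \<mu> j)"
    using M(1) w by (simp add: contact_gen_def ix.hom_mult mult.commute)
  moreover have "{..<n} = insert 0 {1..<n}" using assms(1) by auto
  ultimately have "p = (\<Sum>j<n. ?c j * contact_gen \<mu> j)" by simp
  moreover have "ev (?c 0) = coeff (on_curve p) \<mu>"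
    by (simp add: w coeff_monom_mult poly_0_coeff_0)
  moreover have "\<forall>j\<in>{1..<n}. ev (?c j) = ev (pdiff (Xv (Suc j)) p)" using M(2) by auto
  ultimately show ?thesis by (intro exI[of _ ?c]) simp
qed

text \<open>Let \<open>N\<close> be the matrix that expresses the system by the generators of the contact ideal. The
  matrix in the last assumption is the value of \<open>N\<close> at the point, so \<open>g = det N\<close> does not vanish
  there, and multiplication by the adjugate of \<open>N\<close> shows that \<open>g\<close> times a generator lies in the
  ideal of the system.\<close>

theorem contact_ideal_isolated:
  assumes n: "n \<ge> 1" and \<mu>: "\<mu> \<ge> 1" and F: "F \<in> carrier_vec n" "set\<^sub>v F \<subseteq> carrier (poly_ring n)"
    and contact: "\<And>i. i < n \<Longrightarrow> monom 1 \<mu> dvd on_curve (F $ i)"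
    and nonsing: "det (mat n n (\<lambda>(i, j). if j = 0 then coeff (on_curve (F $ i)) \<mu>
                                        else ev (pdiff (Xv (Suc j)) (F $ i)))) \<noteq> 0" (is "det ?A \<noteq> 0")
  shows "isolated_primary_component (poly_ring n) (system_ideal n F) (point_ideal n x) (contact_ideal n \<mu>)"
proof -
  interpret R: cring "poly_ring n :: 'a mpoly ring" by (rule poly_ring_cring)
  have Fi: "F $ i \<in> set\<^sub>v F" if "i < n" for i using F(1) that by (auto simp: vec_set_def)
  have F_contact: "F $ i \<in> contact_ideal n \<mu>" if "i < n" for i
    using that F(2) Fi contact unfolding contact_ideal_def by auto
  let ?I = "system_ideal n F"
  have I: "ideal ?I (poly_ring n)" unfolding system_ideal_def by (rule R.genideal_ideal[OF F(2)])
  have FI: "F $ i \<in> ?I" if "i < n" for i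
    using R.genideal_self[OF F(2)] Fi[OF that] unfolding system_ideal_def by blast
  have "set\<^sub>v F \<subseteq> contact_ideal n \<mu>" using F_contact F(1) by (auto simp: vec_set_def)
  then have I_sub: "?I \<subseteq> contact_ideal n \<mu>"
    unfolding system_ideal_def by (rule R.genideal_minimal[OF contact_ideal_ideal])
  have "\<forall>i\<in>{..<n}. \<exists>c. F $ i = (\<Sum>j<n. c j * contact_gen \<mu> j) \<and> ev (c 0) = coeff (on_curve (F $ i)) \<mu> \<and>
             (\<forall>j\<in>{1..<n}. ev (c j) = ev (pdiff (Xv (Suc j)) (F $ i)))"
    using contact_expansion[OF n F_contact] by simp
  from bchoice[OF this] obtain c where c: "\<And>i. i < n \<Longrightarrow> F $ i = (\<Sum>j<n. c i j * contact_gen \<mu> j)"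
    "\<And>i. i < n \<Longrightarrow> ev (c i 0) = coeff (on_curve (F $ i)) \<mu>"
    "\<And>i j. i < n \<Longrightarrow> j \<in> {1..<n} \<Longrightarrow> ev (c i j) = ev (pdiff (Xv (Suc j)) (F $ i))"
    by auto
  define N where "N = mat n n (\<lambda>(i, j). c i j)"
  define g where "g = det N"
  have N: "N \<in> carrier_mat n n" by (simp add: N_def)
  have "map_mat ev N = ?A"
    using c by (intro eq_matI) (auto simp: N_def)
  then have ev_g: "ev g \<noteq> 0" using nonsing ev.hom_det[of N] unfolding g_def by metis
  define q where "q = vec n (contact_gen \<mu>)"
  have Nq: "N *\<^sub>v q = F"
    using c F by (intro eq_vecI) (auto simp: N_def q_def scalar_prod_def atLeast0LessThan)
  have "adj_mat N *\<^sub>v F = (adj_mat N * N) *\<^sub>v q"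
    unfolding Nq[symmetric]
    by (rule assoc_mult_mat_vec[symmetric, OF adj_mat(1)[OF N] N]) (simp add: q_def)
  also have "\<dots> = g \<cdot>\<^sub>v q"
    unfolding adj_mat(3)[OF N] g_def
    by (rule eq_vecI) (auto simp: q_def scalar_prod_def if_distrib[of "\<lambda>c. c * _"] if_distrib[of "\<lambda>c. _ * c"] cong: if_cong)
  finally have adj: "adj_mat N *\<^sub>v F = g \<cdot>\<^sub>v q" .
  have gen: "g * contact_gen \<mu> j = (\<Sum>i<n. adj_mat N $$ (j, i) * F $ i)" if "j < n" for j
    using arg_cong[OF adj, of "\<lambda>v. v $ j"] that adj_mat(1)[OF N] F(1)
    by (simp add: q_def scalar_prod_def atLeast0LessThan)
  obtain \<pi> where "comm_ring_hom \<pi>" and \<pi>: "\<And>p. \<pi> p \<in> carrier (poly_ring n)"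
    "\<And>p. p \<in> carrier (poly_ring n) \<Longrightarrow> \<pi> p = p" "\<And>p. ev (\<pi> p) = ev p"
    using projection_onto_poly_ring[of n] by auto
  interpret \<pi>: comm_ring_hom \<pi> by fact
  have "\<pi> g * p \<in> ?I" if p: "p \<in> contact_ideal n \<mu>" for p
  proof -
    obtain d where d: "p = (\<Sum>j<n. d j * contact_gen \<mu> j)" using contact_expansion[OF n p] by blast
    have "g * p = (\<Sum>j<n. d j * (\<Sum>i<n. adj_mat N $$ (j, i) * F $ i))"
      unfolding d sum_distrib_left by (intro sum.cong) (auto simp flip: gen sum_distrib_left)
    also have "\<dots> = (\<Sum>i<n. (\<Sum>j<n. d j * adj_mat N $$ (j, i)) * F $ i)"
      unfolding sum_distrib_left sum_distrib_right by (subst sum.swap) (simp add: mult.assoc)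
    finally have "\<pi> g * \<pi> p = (\<Sum>i<n. \<pi> (\<Sum>j<n. d j * adj_mat N $$ (j, i)) * \<pi> (F $ i))"
      by (simp flip: \<pi>.hom_mult \<pi>.hom_sum)
    also have "\<dots> = (\<Sum>i<n. \<pi> (\<Sum>j<n. d j * adj_mat N $$ (j, i)) * F $ i)"
      using \<pi>(2) F_contact by (intro sum.cong) (simp_all add: contact_ideal_def)
    also have "\<dots> \<in> ?I"
      using I FI \<pi>(1) unfolding ideal_poly_ring_iff ideal_of_def
      by (intro sum_closed_under_add[where P = "\<lambda>p. p \<in> ?I"]) auto
    also have "\<pi> p = p" using p \<pi>(2) unfolding contact_ideal_def by blast
    finally show ?thesis .
  qed
  moreover have "\<pi> g \<notin> radical (poly_ring n) (contact_ideal n \<mu>)"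
    using ev_g \<pi>(3) unfolding radical_contact_ideal[OF \<mu>] by simp
  ultimately show ?thesis
    using R.isolated_primary_componentI[OF poly_ring_noetherian I contact_ideal_primary[OF \<mu>] I_sub \<pi>(1)]
    unfolding radical_contact_ideal[OF \<mu>] point_ideal_eq by simp
qed

text \<open>The quotient has the basis \<open>(x\<^sub>1 - x 1)\<^sup>e\<close>, \<open>e < \<mu>\<close>: the contact orders \<open>\<mu>, \<dots>, 0\<close> give a
  flag in which each step adds one of these powers.\<close>

theorem contact_ideal_codimension:
  assumes "n \<ge> 1"
  shows "ring.dimension (poly_ring n Quot contact_ideal n \<mu>) \<mu>
           (range (\<lambda>c. contact_ideal n \<mu> +>\<^bsub>poly_ring n\<^esub> const_mp c))
           (carrier (poly_ring n Quot contact_ideal n \<mu>))"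
proof -
  let ?R = "poly_ring n :: 'a mpoly ring" and ?Q = "contact_ideal n \<mu>"
  let ?A = "?R Quot ?Q"
  define cls where "cls p = ?Q +>\<^bsub>?R\<^esub> p" for p
  interpret R: cring ?R by (rule poly_ring_cring)
  interpret Q: ideal ?Q ?R by (rule contact_ideal_ideal)
  interpret A: ring ?A by (rule Q.quotient_is_ring)
  have cls: "cls \<in> Ring.ring_hom ?R ?A"
    using Q.rcos_ring_hom unfolding cls_def[abs_def] by simp
  have cls_carrier: "carrier ?A = cls ` carrier ?R"
    by (auto simp: FactRing_def A_RCOSETS_def' cls_def)
  have minus: "p \<ominus>\<^bsub>?R\<^esub> q = p - q" if "p \<in> carrier ?R" "q \<in> carrier ?R" for p q
  proof -
    have "\<ominus>\<^bsub>?R\<^esub> q = - q" using that by (intro R.minus_equality) simp_all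
    then show ?thesis by (simp add: a_minus_def)
  qed
  have cls_eq: "cls p = cls q \<longleftrightarrow> p - q \<in> ?Q" if "p \<in> carrier ?R" "q \<in> carrier ?R" for p q
    using R.quotient_eq_iff_same_a_r_cos[OF Q.ideal_axioms that] minus[OF that] unfolding cls_def by simp
  have sub: "contact_ideal n \<nu> \<subseteq> carrier ?R" for \<nu> unfolding contact_ideal_def by blast
  define E where "E k = cls ` contact_ideal n (\<mu> - k)" for k
  have "A.dimension k (range (\<lambda>c. cls (const_mp c))) (E k)" if "k \<le> \<mu>" for k
    using that
  proof (induction k)
    case 0
    have zero: "0 \<in> ?Q" using contact_ideal_ideal unfolding ideal_poly_ring_iff ideal_of_def by blast
    have "cls p = \<zero>\<^bsub>?A\<^esub>" if "p \<in> ?Q" for p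
      using R.a_rcos_zero[OF Q.ideal_axioms that] by (simp add: cls_def FactRing_def)
    then have "E 0 = {\<zero>\<^bsub>?A\<^esub>}" using zero by (auto simp: E_def)
    then show ?case by (simp add: A.zero_dim)
  next
    case (Suc k)
    define e where "e = \<mu> - Suc k"
    have e: "\<mu> - k = Suc e" "e < \<mu>" using Suc.prems by (auto simp: e_def)
    define t where "t = (var_mp (Xv 1) - const_mp (x 1)) ^ e"
    have "var_mp (Xv 1) - const_mp (x 1) \<in> carrier ?R"
      using var_in_poly_ring[OF atLeastAtMost_iff[THEN iffD2], of 1 n] assms
        R.minus_closed[of "var_mp (Xv 1)" "const_mp (x 1)"] minus[of "var_mp (Xv 1)" "const_mp (x 1)"] by simp
    then have t: "t \<in> carrier ?R" unfolding t_def poly_ring_pow[where n = n, symmetric] by (rule R.nat_pow_closed)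
    have on_t: "on_curve t = monom 1 e"
      by (simp add: t_def on.hom_power on.hom_minus X_1[simplified] monom_altdef)
    have "cls t \<notin> E k"
    proof
      assume "cls t \<in> E k"
      then obtain p where p: "p \<in> contact_ideal n (Suc e)" "cls t = cls p" unfolding E_def e by auto
      then have "t - p \<in> ?Q" using cls_eq t sub by blast
      then have "coeff (on_curve t - on_curve p) e = 0"
        using e by (simp add: contact_ideal_def monom_1_dvd_iff' on.hom_minus)
      moreover have "coeff (on_curve p) e = 0" using p(1) by (simp add: contact_ideal_def monom_1_dvd_iff')
      ultimately show False by (simp add: on_t)
    qed
    moreover have "cls t \<in> carrier ?A" using t cls_carrier by blast
    ultimately have "A.dimension (Suc k) (range (\<lambda>c. cls (const_mp c)))
        (A.line_extension (range (\<lambda>c. cls (const_mp c))) (cls t) (E k))"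
      using Suc by (intro A.Suc_dim) auto
    moreover have "A.line_extension (range (\<lambda>c. cls (const_mp c))) (cls t) (E k) = E (Suc k)"
    proof -
      have comb: "cls (const_mp c) \<otimes>\<^bsub>?A\<^esub> cls t \<oplus>\<^bsub>?A\<^esub> cls p = cls (const_mp c * t + p)"
        if "p \<in> carrier ?R" for c p
        using ring_hom_mult[OF cls, of "const_mp c" t] ring_hom_add[OF cls, of "const_mp c * t" p]
          t that R.m_closed[of "const_mp c" t] by simp
      have in_Suc: "const_mp c * t + p \<in> contact_ideal n e" if "p \<in> contact_ideal n (Suc e)" for c p
      proof -
        have "const_mp c * t + p \<in> carrier ?R"
          using that sub t R.m_closed[of "const_mp c" t] R.a_closed[of "const_mp c * t" p] by auto
        then show ?thesis using that
          by (auto simp: contact_ideal_def monom_1_dvd_iff' on.hom_add on.hom_mult on_t coeff_monom)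
      qed
      have ex_Suc: "\<exists>c q. q \<in> contact_ideal n (Suc e) \<and> p = const_mp c * t + q" if p: "p \<in> contact_ideal n e" for p
      proof (intro exI conjI)
        let ?c = "coeff (on_curve p) e"
        show "p = const_mp ?c * t + (p - const_mp ?c * t)" by simp
        have "p - const_mp ?c * t \<in> carrier ?R"
          using p sub t R.m_closed[of "const_mp ?c" t] R.minus_closed[of p "const_mp ?c * t"]
            minus[of p "const_mp ?c * t"] by auto
        then show "p - const_mp ?c * t \<in> contact_ideal n (Suc e)"
          using p by (auto simp: contact_ideal_def monom_1_dvd_iff' on.hom_minus on.hom_mult on_t coeff_monom less_Suc_eq)
      qed
      have "E (Suc k) = cls ` contact_ideal n e" by (simp add: E_def e_def)
      moreover have "E k = cls ` contact_ideal n (Suc e)" by (simp add: E_def e)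
      moreover have "A.line_extension (range (\<lambda>c. cls (const_mp c))) (cls t) (cls ` contact_ideal n (Suc e))
          = cls ` contact_ideal n e"
      proof (intro equalityI subsetI)
        fix u assume "u \<in> A.line_extension (range (\<lambda>c. cls (const_mp c))) (cls t) (cls ` contact_ideal n (Suc e))"
        then obtain c p where p: "p \<in> contact_ideal n (Suc e)"
          and u: "u = cls (const_mp c) \<otimes>\<^bsub>?A\<^esub> cls t \<oplus>\<^bsub>?A\<^esub> cls p"
          unfolding A.line_extension_mem_iff by auto
        have "p \<in> carrier ?R" using p sub by blast
        from u[unfolded comb[OF this]] show "u \<in> cls ` contact_ideal n e"
          using in_Suc[OF p] by (rule image_eqI)
      next
        fix u assume "u \<in> cls ` contact_ideal n e"
        then obtain p where p: "p \<in> contact_ideal n e" and u: "u = cls p" by auto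
        obtain c q where q: "q \<in> contact_ideal n (Suc e)" "p = const_mp c * t + q" using ex_Suc[OF p] by auto
        have "q \<in> carrier ?R" using q(1) sub by blast
        then have "u = cls (const_mp c) \<otimes>\<^bsub>?A\<^esub> cls t \<oplus>\<^bsub>?A\<^esub> cls q"
          unfolding u q(2) by (rule comb[symmetric])
        then show "u \<in> A.line_extension (range (\<lambda>c. cls (const_mp c))) (cls t) (cls ` contact_ideal n (Suc e))"
          unfolding A.line_extension_mem_iff using q(1) by (intro bexI[of _ "cls (const_mp c)"] bexI[of _ "cls q"]) auto
      qed
      ultimately show ?thesis by simp
    qed
    ultimately show ?case by simp
  qed
  from this[of \<mu>] have "A.dimension \<mu> (range (\<lambda>c. cls (const_mp c))) (cls ` contact_ideal n 0)"
    by (simp add: E_def)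
  moreover have "contact_ideal n 0 = carrier ?R" by (simp add: contact_ideal_def)
  ultimately show ?thesis using cls_carrier unfolding cls_def by simp
qed

end

section \<open>The deflated system as Taylor coefficients\<close>

text \<open>The columns of \<open>B\<close> are independent, and all of them except the first also occur in \<open>A\<close>; so
  the rank of \<open>A\<close> is at least \<open>n - 1\<close>.\<close>

lemma corank_eq_1I:
  fixes A B :: "'a::field mat"
  assumes n: "n \<ge> 1" and A: "A \<in> carrier_mat n n" and B: "B \<in> carrier_mat n n"
    and "det A = 0" and "det B \<noteq> 0"
    and cols: "\<And>j. 1 \<le> j \<Longrightarrow> j < n \<Longrightarrow> col A j = col B j"
  shows "corank n A = 1"
proof -
  interpret vec_space "TYPE('a)" n .
  have rank_B: "rank B = n" using low_rank_det_zero[OF B assms(5)] .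
  then have dist: "distinct (cols B)" using non_distinct_low_rank[OF B] by auto
  have indep: "lin_indpt (set (cols B))" by (rule full_rank_lin_indpt[OF B rank_B dist])
  let ?U = "set (cols B) - {col B 0}"
  have colsB: "set (cols B) = col B ` {0..<n}" using B by (auto simp: cols_def)
  have "?U \<subseteq> set (cols A)"
  proof
    fix u assume "u \<in> ?U"
    then obtain j where "j < n" "u = col B j" unfolding colsB by auto
    moreover from this have "j \<noteq> 0" using \<open>u \<in> ?U\<close> by auto
    ultimately
    have "u = col A j" using cols[of j] by simp
    then show "u \<in> set (cols A)" using \<open>j < n\<close> A by (auto simp: cols_def)
  qed
  moreover have "lin_indpt ?U"
    using subset_li_is_li[OF indep, of ?U] by blast
  ultimately have "card ?U \<le> rank A" by (rule rank_ge_card_indpt[OF A])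
  moreover have "card (set (cols B)) = n" using dist B by (simp add: distinct_card)
  moreover have "col B 0 \<in> set (cols B)" using n unfolding colsB by auto
  ultimately have "n - 1 \<le> rank A" by simp
  moreover have "rank A < n" by (rule det_zero_low_rank[OF A assms(4)])
  ultimately show ?thesis unfolding corank_def by linarith
qed

text \<open>Coordinate \<open>i\<close> of \<open>a\<^sub>k\<close> as a polynomial, with coordinates numbered from 1.\<close>

definition arc_coeff :: "nat \<Rightarrow> nat \<Rightarrow> nat \<Rightarrow> 'a::comm_ring_1 mpoly" where
  "arc_coeff n k i = (if i \<in> {1..n} then a_vec n k $ (i - 1) else 0)"

text \<open>Substitutes the generic arc \<open>x + a\<^sub>2 t + \<dots> + a\<^sub>\<mu> t\<^bsup>\<mu>-1\<^esup>\<close>, whose coefficients are the variables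
  of the deflated system, for \<open>x\<close>.\<close>

definition arc_subst :: "nat \<Rightarrow> nat \<Rightarrow> 'a::comm_ring_1 mpoly \<Rightarrow> 'a mpoly poly" where
  "arc_subst n \<mu> = insertion_mp (\<lambda>c. [:const_mp c:]) (\<lambda>v. [:var_mp v:] +
     (case v of Xv i \<Rightarrow> \<Sum>j=1..<\<mu>. monom (arc_coeff n (j + 1) i) j | _ \<Rightarrow> 0))"

text \<open>The directional derivative \<open>p \<mapsto> J\<^sub>p a\<^sub>k\<close>.\<close>

definition arc_deriv :: "nat \<Rightarrow> nat \<Rightarrow> 'a::comm_ring_1 mpoly \<Rightarrow> 'a mpoly" where
  "arc_deriv n k p = (\<Sum>i=1..n. arc_coeff n k i * pdiff (Xv i) p)"

lemma const_poly_hom': "comm_ring_hom (\<lambda>c. [:const_mp c:])"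
  by (rule comm_ring_hom_comp[OF constant_poly_hom const_mp_hom])

lemma arc_subst_hom: "comm_ring_hom (arc_subst n \<mu>)"
  unfolding arc_subst_def by (rule insertion_mp_hom[OF const_poly_hom'])

lemma arc_subst_const [simp]: "arc_subst n \<mu> (const_mp c) = [:const_mp c:]"
  by (simp add: arc_subst_def)

lemma arc_subst_Xv: "arc_subst n \<mu> (var_mp (Xv i)) = [:var_mp (Xv i):] + (\<Sum>j=1..<\<mu>. monom (arc_coeff n (j + 1) i) j)"
  by (simp add: arc_subst_def const_poly_hom')

lemma arc_subst_Bv [simp]: "arc_subst n \<mu> (var_mp (Bv i)) = [:var_mp (Bv i):]"
  and arc_subst_Av [simp]: "arc_subst n \<mu> (var_mp (Av k i)) = [:var_mp (Av k i):]"
  by (simp_all add: arc_subst_def const_poly_hom')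

lemma arc_subst_at_0: "poly (arc_subst n \<mu> p) 0 = p"
proof (rule ring_hom_eq_on_mpoly[where V = UNIV and \<psi> = "\<lambda>p. p", OF comm_ring_hom_comp[OF poly_hom arc_subst_hom] id_hom])
  show "poly (arc_subst n \<mu> (var_mp v)) 0 = var_mp v" for v
    by (cases v) (simp_all add: arc_subst_Xv poly_sum poly_monom power_0_left)
qed simp_all

lemma coeff_map_poly_derivation:
  assumes "derivation_along \<phi> D"
  shows "coeff (map_poly D r) k = D (coeff r k)"
  using derivation_along_const[OF assms, of 0] by (simp add: coeff_map_poly)

lemma derivation_along_map_poly:
  assumes D: "derivation_along \<phi> D" and T: "comm_ring_hom T" and \<phi>: "comm_ring_hom \<phi>"
    and const: "\<And>c. map_poly D (T (const_mp c)) = 0"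
  shows "derivation_along (\<lambda>p. map_poly \<phi> (T p)) (\<lambda>p. map_poly D (T p))"
proof (rule derivation_alongI)
  interpret T: comm_ring_hom T by fact
  interpret \<phi>: comm_ring_hom \<phi> by fact
  have D_sum: "D (\<Sum>i\<in>A. f i) = (\<Sum>i\<in>A. D (f i))" for f :: "nat \<Rightarrow> _" and A
    using derivation_along_const[OF D, of 0]
    by (induction A rule: infinite_finite_induct) (simp_all add: derivation_along_add[OF D])
  show "map_poly D (T (p + q)) = map_poly D (T p) + map_poly D (T q)" for p q
    by (rule poly_eqI) (simp add: coeff_map_poly_derivation[OF D] T.hom_add derivation_along_add[OF D])
  show "map_poly D (T (p * q)) = map_poly D (T p) * map_poly \<phi> (T q) + map_poly \<phi> (T p) * map_poly D (T q)" for p q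
    by (rule poly_eqI)
      (simp add: coeff_map_poly_derivation[OF D] T.hom_mult coeff_mult D_sum derivation_along_mult[OF D]
        sum.distrib coeff_map_poly)
qed (rule const)

lemma derivation_arc_deriv: "derivation_along (\<lambda>p. p) (arc_deriv n k)"
  unfolding arc_deriv_def
  by (intro derivation_along_sum derivation_along_scale derivation_pdiff)

lemma arc_deriv_Xv: "arc_deriv n k (var_mp (Xv i)) = arc_coeff n k i"
  by (simp add: arc_deriv_def pdiff_var if_distrib[of "\<lambda>c. _ * c"] arc_coeff_def cong: if_cong)

lemma arc_coeff_eq:
  "arc_coeff n k i = (if i \<in> {1..n} then if i = 1 then (if k = 2 then 1 else 0) else var_mp (Av k i) else 0)"
  by (auto simp: arc_coeff_def a_vec_def)

lemma arc_deriv_arc_coeff: "arc_deriv n k (arc_coeff n l i) = 0"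
  by (simp add: arc_deriv_def arc_coeff_eq[of n l] pdiff_var)

lemma map_poly_constant [simp]: "f 0 = 0 \<Longrightarrow> map_poly f [:c:] = [:f c:]"
  by (simp add: map_poly_pCons)

text \<open>The operator \<open>t d/dt\<close>. It keeps degrees, so comparing coefficients of \<open>t\<^sup>m\<close> below needs no
  shift of indices.\<close>

definition euler_op :: "'b::comm_ring_1 poly \<Rightarrow> 'b poly" where
  "euler_op r = (\<Sum>i\<le>degree r. monom (of_nat i * coeff r i) i)"

lemma coeff_euler_op: "coeff (euler_op r) m = of_nat m * coeff r m"
proof -
  have "coeff (euler_op r) m = (\<Sum>i\<le>degree r. if i = m then of_nat i * coeff r i else 0)"
    by (simp add: euler_op_def coeff_sum)
  also have "\<dots> = of_nat m * coeff r m"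
    by (simp add: coeff_eq_0)
  finally show ?thesis .
qed

lemma euler_op_add: "euler_op (r + s) = euler_op r + euler_op s"
  by (rule poly_eqI) (simp add: coeff_euler_op distrib_left)

lemma euler_op_mult: "euler_op (r * s) = euler_op r * s + r * euler_op s"
proof (rule poly_eqI)
  fix m
  have "coeff (euler_op (r * s)) m = (\<Sum>i\<le>m. of_nat m * (coeff r i * coeff s (m - i)))"
    by (simp add: coeff_euler_op coeff_mult sum_distrib_left)
  also have "\<dots> = (\<Sum>i\<le>m. of_nat i * coeff r i * coeff s (m - i) + coeff r i * (of_nat (m - i) * coeff s (m - i)))"
  proof (rule sum.cong)
    fix i assume "i \<in> {..m}"
    then have "(of_nat m :: 'a) = of_nat i + of_nat (m - i)" by (simp flip: of_nat_add)
    then show "of_nat m * (coeff r i * coeff s (m - i))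
        = of_nat i * coeff r i * coeff s (m - i) + coeff r i * (of_nat (m - i) * coeff s (m - i))"
      by (simp only: algebra_simps)
  qed simp
  also have "\<dots> = coeff (euler_op r * s + r * euler_op s) m"
    by (simp add: coeff_mult coeff_euler_op sum.distrib)
  finally show "coeff (euler_op (r * s)) m = coeff (euler_op r * s + r * euler_op s) m" .
qed

text \<open>The chain rule along the generic arc: both sides are derivations along the substitution, and
  they agree on the variables.\<close>

lemma euler_op_arc_subst:
  fixes p :: "'a::comm_ring_1 mpoly"
  shows "euler_op (arc_subst n \<mu> p)
    = (\<Sum>j=1..<\<mu>. monom (of_nat j) j * map_poly (arc_deriv n (j + 1)) (arc_subst n \<mu> p))"
proof (rule derivation_along_eq[where V = UNIV and \<phi> = "arc_subst n \<mu>"])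
  interpret T: comm_ring_hom "arc_subst n \<mu> :: 'a mpoly \<Rightarrow> _" by (rule arc_subst_hom)
  have D0: "arc_deriv n k 0 = (0 :: 'a mpoly)" for k
    using derivation_along_const[OF derivation_arc_deriv, of n k 0] by simp
  show "derivation_along (arc_subst n \<mu>) (\<lambda>p. euler_op (arc_subst n \<mu> p) :: 'a mpoly poly)"
  proof (rule derivation_alongI)
    show "euler_op (arc_subst n \<mu> (const_mp c :: 'a mpoly)) = 0" for c
      by (rule poly_eqI) (simp add: coeff_euler_op coeff_pCons split: nat.split)
  qed (simp_all add: T.hom_add T.hom_mult euler_op_add euler_op_mult)
  have "derivation_along (\<lambda>p. map_poly (\<lambda>p. p) (arc_subst n \<mu> p)) (\<lambda>p. map_poly (arc_deriv n k) (arc_subst n \<mu> p) :: 'a mpoly poly)" for k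
    by (rule derivation_along_map_poly[OF derivation_arc_deriv arc_subst_hom id_hom])
      (simp add: D0 derivation_along_const[OF derivation_arc_deriv])
  then have "derivation_along (arc_subst n \<mu>) (\<lambda>p. map_poly (arc_deriv n k) (arc_subst n \<mu> p) :: 'a mpoly poly)" for k
    by (simp add: map_poly_idI)
  then show "derivation_along (arc_subst n \<mu>) (\<lambda>p. \<Sum>j=1..<\<mu>. monom (of_nat j) j *
      map_poly (arc_deriv n (j + 1)) (arc_subst n \<mu> p) :: 'a mpoly poly)"
    by (intro derivation_along_sum derivation_along_scale)
  show "euler_op (arc_subst n \<mu> (var_mp v)) = ((\<Sum>j=1..<\<mu>. monom (of_nat j) j *
      map_poly (arc_deriv n (j + 1)) (arc_subst n \<mu> (var_mp v))) :: 'a mpoly poly)"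
    for v
  proof (cases v)
    case (Xv i)
    have D_sum: "arc_deriv n k (\<Sum>j\<in>A. f j) = (\<Sum>j\<in>A. arc_deriv n k (f j))" for k A and f :: "nat \<Rightarrow> 'a mpoly"
      by (induction A rule: infinite_finite_induct) (simp_all add: D0 derivation_along_add[OF derivation_arc_deriv])
    have "coeff (map_poly (arc_deriv n k) (arc_subst n \<mu> (var_mp v))) m = coeff [:arc_coeff n k i :: 'a mpoly:] m" for k m
      by (simp add: Xv arc_subst_Xv coeff_map_poly_derivation[OF derivation_arc_deriv] coeff_sum
          derivation_along_add[OF derivation_arc_deriv] arc_deriv_Xv coeff_pCons D_sum D0
          if_distrib[of "arc_deriv n k"] arc_deriv_arc_coeff split: nat.split cong: if_cong)
    then have D: "map_poly (arc_deriv n k) (arc_subst n \<mu> (var_mp v)) = [:arc_coeff n k i :: 'a mpoly:]" for k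
      by (rule poly_eqI)
    show ?thesis
    proof (rule poly_eqI)
      fix m
      have "coeff (euler_op (arc_subst n \<mu> (var_mp v))) m
          = (\<Sum>j=1..<\<mu>. of_nat m * (if j = m then arc_coeff n (j + 1) i else (0 :: 'a mpoly)))"
      proof -
        have "coeff (arc_subst n \<mu> (var_mp v)) m = coeff [:var_mp v :: 'a mpoly:] m
            + (\<Sum>j=1..<\<mu>. if j = m then arc_coeff n (j + 1) i else 0)"
          by (simp only: Xv arc_subst_Xv coeff_add coeff_sum coeff_monom)
        moreover have "of_nat m * coeff [:var_mp v :: 'a mpoly:] m = 0" by (cases m) simp_all
        ultimately show ?thesis
          unfolding coeff_euler_op by (simp only: distrib_left sum_distrib_left add_0)
      qed
      also have "\<dots> = coeff (\<Sum>j=1..<\<mu>. monom (of_nat j) j * [:arc_coeff n (j + 1) i:]) m"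
        unfolding coeff_sum by (rule sum.cong) (auto simp: coeff_monom_mult coeff_pCons split: nat.split)
      finally show "coeff (euler_op (arc_subst n \<mu> (var_mp v :: 'a mpoly))) m =
        coeff (\<Sum>j=1..<\<mu>. monom (of_nat j) j * map_poly (arc_deriv n (j + 1)) (arc_subst n \<mu> (var_mp v))) m"
        unfolding D .
    qed
  next
    case (Bv \<nu>)
    have "arc_deriv n k (var_mp (Bv \<nu>)) = (0 :: 'a mpoly)" for k
      by (simp add: arc_deriv_def pdiff_var)
    then show ?thesis
      by (intro poly_eqI) (simp add: Bv D0 coeff_euler_op coeff_pCons split: nat.split)
  next
    case (Av l i)
    have "arc_deriv n k (var_mp (Av l i)) = (0 :: 'a mpoly)" for k
      by (simp add: arc_deriv_def pdiff_var)
    then show ?thesis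
      by (intro poly_eqI) (simp add: Av D0 coeff_euler_op coeff_pCons split: nat.split)
  qed
qed simp

lemma arc_coeff_recursion:
  fixes p :: "'a::comm_ring_1 mpoly"
  assumes "m < \<mu>"
  shows "of_nat m * coeff (arc_subst n \<mu> p) m
    = (\<Sum>j=1..m. of_nat j * arc_deriv n (j + 1) (coeff (arc_subst n \<mu> p) (m - j)))"
proof -
  let ?c = "coeff (arc_subst n \<mu> p)"
  have "of_nat m * ?c m = (\<Sum>j=1..<\<mu>. if m < j then 0 else of_nat j * arc_deriv n (j + 1) (?c (m - j)))"
    unfolding coeff_euler_op[symmetric] euler_op_arc_subst coeff_sum
    by (intro sum.cong) (simp_all add: coeff_monom_mult coeff_map_poly_derivation[OF derivation_arc_deriv])
  also have "\<dots> = (\<Sum>j=1..m. of_nat j * arc_deriv n (j + 1) (?c (m - j)))"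
    using assms by (intro sum.mono_neutral_cong_right) auto
  finally show ?thesis .
qed

lemma jacobian_times_a_vec:
  assumes "H \<in> carrier_vec n" "i < n"
  shows "(jacobian (xvars n) H *\<^sub>v a_vec n k) $ i = arc_deriv n k (H $ i)"
proof -
  have "(jacobian (xvars n) H *\<^sub>v a_vec n k) $ i
      = (\<Sum>j<n. pdiff (xvars n ! j) (H $ i) * a_vec n k $ j)"
    using assms by (simp add: jacobian_def scalar_prod_def a_vec_def xvars_def atLeast0LessThan)
  also have "\<dots> = (\<Sum>j<n. a_vec n k $ j * pdiff (Xv (Suc j)) (H $ i))"
    by (intro sum.cong) (auto simp: xvars_def nth_append mult.commute simp del: upt_Suc)
  also have "\<dots> = arc_deriv n k (H $ i)"
    unfolding arc_deriv_def
    by (rule sum.reindex_bij_witness[of _ "\<lambda>j. j - 1" Suc]) (auto simp: arc_coeff_def)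
  finally show ?thesis .
qed

text \<open>Dividing the recursion by \<open>k - 1\<close> turns it into the one that defines \<open>L\<close>.\<close>

lemma L_eq_arc_coeff:
  fixes H :: "'a::field_char_0 mpoly vec"
  assumes H: "H \<in> carrier_vec n" and "2 \<le> k" "k \<le> \<mu>"
  shows "L n H k = vec n (\<lambda>i. coeff (arc_subst n \<mu> (H $ i)) (k - 1))"
  using assms(2,3)
proof (induction k rule: less_induct)
  case (less k)
  let ?c = "\<lambda>i. coeff (arc_subst n \<mu> (H $ i))"
  interpret const: comm_ring_hom "const_mp :: 'a \<Rightarrow> 'a mpoly" by (rule const_mp_hom)
  have dim: "dim_vec (L n H k) = n"
    using less.prems by (simp add: L.simps[of n H k] jacobian_def H[THEN carrier_vecD])
  have inv: "const_mp (of_nat j / of_nat (k - 1)) = const_mp (1 / of_nat (k - 1)) * (of_nat j :: 'a mpoly)" for j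
  proof -
    have "(of_nat j :: 'a mpoly) = const_mp (of_nat j)" by (simp add: const_mp_def)
    then show ?thesis by (simp only: const.hom_mult[symmetric] times_divide_eq_left mult_1_left)
  qed
  have "L n H k $ i = ?c i (k - 1)" if i: "i < n" for i
  proof -
    have L: "L n H k $ i = (\<Sum>j=1..k - 2. const_mp (of_nat j / of_nat (k - 1)) * arc_deriv n (j + 1) (?c i (k - 1 - j)))
        + arc_deriv n k (H $ i)"
    proof -
      have "(jacobian (xvars n) (L n H (k - j)) *\<^sub>v a_vec n (j + 1)) $ i = arc_deriv n (j + 1) (?c i (k - 1 - j))"
        if j: "j \<in> {1..k - 2}" for j
      proof -
        have "L n H (k - j) = vec n (\<lambda>i. ?c i (k - j - 1))"
          using j less.prems by (intro less.IH) auto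
        then show ?thesis
          using jacobian_times_a_vec[of "L n H (k - j)" n i "j + 1"] i by (simp add: diff_commute)
      qed
      moreover have "k = 2 \<or> k > 2" using less.prems by auto
      ultimately show ?thesis
        using i jacobian_times_a_vec[OF H i, of k] H
        by (auto simp: L.simps[of n H k] jacobian_def)
    qed
    have top: "?c i 0 = H $ i" using arc_subst_at_0[of n \<mu> "H $ i"] by (simp add: poly_0_coeff_0)
    have "of_nat (k - 1) * ?c i (k - 1) = (\<Sum>j=1..k - 1. of_nat j * arc_deriv n (j + 1) (?c i (k - 1 - j)))"
      using less.prems by (intro arc_coeff_recursion) auto
    also have "{1..k - 1} = insert (k - 1) {1..k - 2}" using less.prems by auto
    also have "(\<Sum>j\<in>insert (k - 1) {1..k - 2}. of_nat j * arc_deriv n (j + 1) (?c i (k - 1 - j)))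
        = (\<Sum>j=1..k - 2. of_nat j * arc_deriv n (j + 1) (?c i (k - 1 - j))) + of_nat (k - 1) * arc_deriv n k (H $ i)"
      using less.prems by (subst sum.insert) (auto simp: top)
    finally have "const_mp (1 / of_nat (k - 1)) * (of_nat (k - 1) * ?c i (k - 1))
        = (\<Sum>j=1..k - 2. const_mp (of_nat j / of_nat (k - 1)) * arc_deriv n (j + 1) (?c i (k - 1 - j)))
          + const_mp (1 / of_nat (k - 1)) * of_nat (k - 1) * arc_deriv n k (H $ i)"
      by (simp only: inv distrib_left sum_distrib_left mult.assoc)
    moreover have "const_mp (1 / of_nat (k - 1)) * of_nat (k - 1) = (1 :: 'a mpoly)"
      using inv[of "k - 1"] less.prems by simp
    ultimately show ?thesis unfolding L by (simp only: mult.assoc[symmetric] mult_1_left)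
  qed
  then show ?case using dim by (intro eq_vecI) auto
qed

section \<open>Zeros of the deflated system\<close>

lemma F1_vars:
  fixes F :: "'a::field_char_0 mpoly vec"
  assumes "n \<ge> 1" "F \<in> carrier_vec n" "set\<^sub>v F \<subseteq> carrier (poly_ring n)" "i < n"
  shows "vars_mp (F1 n \<mu> F $ i) \<subseteq> Xv ` {1..n} \<union> range Bv"
proof -
  let ?V = "Xv ` {1..n} \<union> range Bv"
  let ?S = "{p :: 'a mpoly. vars_mp p \<subseteq> ?V}"
  let ?s = "\<lambda>\<nu>. const_mp (1 / fact \<nu>) * var_mp (Bv \<nu>) * var_mp (Xv 1) ^ \<nu> :: 'a mpoly"
  have S: "subring_set ?S" by (rule vars_mp_subring)
  have "F $ i \<in> set\<^sub>v F" using assms by (auto simp: vec_set_def)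
  then have "F $ i \<in> ?S" using assms(3) by (auto simp: xvars_set)
  moreover have "?s \<nu> \<in> ?S" for \<nu>
    using assms(1) by (intro subring_setD(4,7)[OF S]) auto
  then have "(\<Sum>\<nu>=0..\<mu> - 2. ?s \<nu>) \<in> ?S"
    by (intro sum_closed_under_add[where P = "\<lambda>p. p \<in> ?S"] subring_setD(1,3)[OF S]) auto
  moreover have "(unit_vec n 0 :: 'a mpoly vec) $ i \<in> ?S"
    using assms(4) by (simp add: unit_vec_def)
  ultimately have "F $ i - (\<Sum>\<nu>=0..\<mu> - 2. ?s \<nu>) * unit_vec n 0 $ i \<in> ?S"
    by (intro subring_setD(4,6)[OF S])
  then show ?thesis using assms(2,4) by (simp add: F1_def)
qed

lemma F1_carrier: "F \<in> carrier_vec n \<Longrightarrow> F1 n \<mu> F \<in> carrier_vec n"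
  by (simp add: F1_def)

text \<open>Uniform access to the blocks of \<open>G\<close>: for \<open>m \<ge> 1\<close> by the recursion for \<open>L\<close>, while the block \<open>F\<^sub>1\<close>
  is the coefficient of \<open>t\<^sup>0\<close>.\<close>

lemma G_entry:
  fixes F :: "'a::field_char_0 mpoly vec"
  assumes "n \<ge> 1" "F \<in> carrier_vec n" "i < n" "m < \<mu>"
  shows "G n \<mu> F $ (m * n + i) = coeff (arc_subst n \<mu> (F1 n \<mu> F $ i)) m"
proof -
  have "m * n + i < \<mu> * n"
  proof -
    have "m * n + i < Suc m * n" using assms(3) by simp
    also have "\<dots> \<le> \<mu> * n" using assms(4) by (intro mult_le_mono1) simp
    finally show ?thesis .
  qed
  then have *: "G n \<mu> F $ (m * n + i) = (if m = 0 then F1 n \<mu> F else L n (F1 n \<mu> F) (m + 1)) $ i"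
    using assms(1,3) by (simp add: G_def)
  show ?thesis
  proof (cases "m = 0")
    case True
    then show ?thesis using * arc_subst_at_0[of n \<mu> "F1 n \<mu> F $ i"] by (simp add: poly_0_coeff_0)
  next
    case False
    then show ?thesis
      using * assms L_eq_arc_coeff[OF F1_carrier[OF assms(2)], of "m + 1" \<mu>] by simp
  qed
qed

lemma distinct_all_vars: "distinct (all_vars n \<mu>)"
proof -
  have "[Av k j. k \<leftarrow> ks, j \<leftarrow> js] = map (\<lambda>(k, j). Av k j) (List.product ks js)" for ks js
    by (induction ks) (simp_all add: comp_def)
  then have "distinct [Av k j. k \<leftarrow> [2..<Suc \<mu>], j \<leftarrow> [2..<Suc n]]"
    by (simp add: distinct_map distinct_product inj_on_def del: upt_Suc)
  then show ?thesis
    by (auto simp: all_vars_def xvars_def distinct_map inj_on_def simp del: upt_Suc)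
qed

lemma set_all_vars: "set (all_vars n \<mu>) = Xv ` {1..n} \<union> Bv ` {0..<\<mu> - 1} \<union> {Av k j |k j. k \<in> {2..\<mu>} \<and> j \<in> {2..n}}"
proof -
  have "set [Av k j. k \<leftarrow> [2..<Suc \<mu>], j \<leftarrow> [2..<Suc n]] = {Av k j |k j. k \<in> {2..\<mu>} \<and> j \<in> {2..n}}"
    by (auto simp: atLeastLessThanSuc_atLeastAtMost simp del: upt_Suc)
  then show ?thesis by (simp add: all_vars_def xvars_set Un_assoc del: upt_Suc)
qed

text \<open>A zero of the deflated system fixes the coefficients of the generic arc: \<open>arc\<close> below is the
  substitution of the resulting arc, and its coordinates form a curve through \<open>x\<close>.\<close>

locale deflation_zero =
  fixes F :: "'a::field_char_0 mpoly vec" and n \<mu> :: nat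
    and x b :: "nat \<Rightarrow> 'a" and a :: "nat \<Rightarrow> nat \<Rightarrow> 'a"
  assumes n: "n \<ge> 1" and \<mu>: "\<mu> \<ge> 2"
    and F: "F \<in> carrier_vec n" "set\<^sub>v F \<subseteq> carrier (poly_ring n)"
    and G_zero: "map_vec (eval_mp (full_point x b a)) (G n \<mu> F) = 0\<^sub>v (\<mu> * n)"
begin

abbreviation E :: "'a mpoly \<Rightarrow> 'a" where "E \<equiv> eval_mp (full_point x b a)"

abbreviation H :: "nat \<Rightarrow> 'a mpoly" where "H i \<equiv> F1 n \<mu> F $ i"

definition arc :: "'a mpoly \<Rightarrow> 'a poly" where
  "arc p = map_poly E (arc_subst n \<mu> p)"

sublocale E: comm_ring_hom E
  by (rule eval_mp_hom)

sublocale arc: comm_ring_hom arc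
  unfolding arc_def by (rule comm_ring_hom_comp[OF map_poly_hom[OF eval_mp_hom] arc_subst_hom])

lemma E_var [simp]: "E (var_mp v) = full_point x b a v"
  by (simp add: id_hom)

lemma coeff_arc: "coeff (arc p) m = E (coeff (arc_subst n \<mu> p) m)"
  by (simp add: arc_def coeff_map_poly)

lemma arc_const [simp]: "arc (const_mp c) = [:c:]"
  by (simp add: arc_def)

lemma arc_Bv [simp]: "arc (var_mp (Bv \<nu>)) = [:b \<nu>:]"
  by (simp add: arc_def full_point_def)

lemma coeff_arc_Xv:
  "coeff (arc (var_mp (Xv i))) m = (if m = 0 then x i else if m < \<mu> then E (arc_coeff n (m + 1) i) else 0)"
  by (cases m) (simp_all add: coeff_arc arc_subst_Xv coeff_sum full_point_def E.hom_add)

lemma arc_at_0: "coeff (arc p) 0 = E p"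
  using arc_subst_at_0[of n \<mu> p] by (simp add: coeff_arc poly_0_coeff_0)

sublocale curve x "\<lambda>i. arc (var_mp (Xv i))"
proof
  show "poly (arc (var_mp (Xv i))) 0 = x i" for i by (simp add: poly_0_coeff_0 coeff_arc_Xv)
  show "arc (var_mp (Xv 1)) = [:x 1, 1:]"
  proof (rule poly_eqI)
    show "coeff (arc (var_mp (Xv 1))) m = coeff [:x 1, 1:] m" for m
      using n \<mu> by (cases m) (auto simp: coeff_arc_Xv arc_coeff_eq coeff_pCons split: nat.split)
  qed
qed

lemma H_vars: "i < n \<Longrightarrow> vars_mp (H i) \<subseteq> Xv ` {1..n} \<union> range Bv"
  by (rule F1_vars[OF n F])

lemma arc_H_low:
  assumes "i < n" "m < \<mu>" shows "coeff (arc (H i)) m = 0"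
proof -
  have "m * n + i < Suc m * n" using assms(1) by simp
  also have "\<dots> \<le> \<mu> * n" using assms(2) by (intro mult_le_mono1) simp
  finally have r: "m * n + i < \<mu> * n" .
  have "E (G n \<mu> F $ (m * n + i)) = map_vec E (G n \<mu> F) $ (m * n + i)"
    using r by (simp add: G_def)
  also have "\<dots> = 0" unfolding G_zero using r by simp
  finally show ?thesis using G_entry[OF n F(1) assms] by (simp add: coeff_arc)
qed

text \<open>The matrix of the theorem \<open>contact_ideal_isolated\<close>, written with \<open>F\<^sub>1\<close> instead of \<open>F\<^sub>0\<close>.\<close>

definition contact_mat :: "'a mat" where
  "contact_mat = mat n n (\<lambda>(i, j). if j = 0 then coeff (arc (H i)) \<mu> else E (pdiff (Xv (Suc j)) (H i)))"

text \<open>The deformation of the arc \<open>X\<close> in the direction \<open>v\<^sub>1 X'(t) + \<mu> t\<^bsup>\<mu>-1\<^esup> (0, v\<^sub>2, \<dots>, v\<^sub>n)\<close>. The first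
  coordinate of \<open>X'\<close> is the constant 1, so this respects the fixed first components of the \<open>a\<^sub>k\<close>.
  The derivative of \<open>a\<^sub>\<mu> t\<^bsup>\<mu>-1\<^esup>\<close> contributes to \<open>a\<^bsub>\<mu>-1\<^esub>\<close> only, and \<open>v\<close> takes the place of the
  missing coefficient \<open>a\<^bsub>\<mu>+1\<^esub>\<close>.\<close>

definition tangent :: "'a vec \<Rightarrow> var \<Rightarrow> 'a" where
  "tangent v w = (case w of Xv i \<Rightarrow> v $ 0 * E (arc_coeff n 2 i) | Bv \<nu> \<Rightarrow> 0
     | Av k i \<Rightarrow> if k < \<mu> then v $ 0 * of_nat k * E (arc_coeff n (k + 1) i) else of_nat \<mu> * v $ (i - 1))"

text \<open>Multiplication of \<open>J\<^sub>G\<close> by the tangent vector, applied to a single polynomial.\<close>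

definition along_tangent :: "'a vec \<Rightarrow> 'a mpoly \<Rightarrow> 'a" where
  "along_tangent v p = (\<Sum>w\<in>set (all_vars n \<mu>). tangent v w * E (pdiff w p))"

lemma derivation_along_tangent: "derivation_along E (along_tangent v)"
  unfolding along_tangent_def
  by (rule derivation_along_sum,
      rule derivation_along_scale[OF derivation_along_hom[OF derivation_pdiff E.comm_ring_hom_axioms]])

lemma along_tangent_var:
  "along_tangent v (var_mp w) = (if w \<in> set (all_vars n \<mu>) then tangent v w else 0)"
  by (simp add: along_tangent_def pdiff_var if_distrib[of E] if_distrib[of "\<lambda>c. _ * c"] cong: if_cong)

lemma along_tangent_0 [simp]: "along_tangent v 0 = 0"
  using derivation_along_const[OF derivation_along_tangent, of v 0] by simp

lemma along_tangent_1 [simp]: "along_tangent v 1 = 0"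
  using derivation_along_const[OF derivation_along_tangent, of v 1] by simp

lemma along_tangent_arc_coeff:
  assumes "i \<in> {1..n}" "m \<in> {1..<\<mu>}"
  shows "along_tangent v (arc_coeff n (m + 1) i) = (if m + 1 < \<mu> then v $ 0 * of_nat (m + 1) * E (arc_coeff n (m + 2) i)
     else if i = 1 then 0 else of_nat \<mu> * v $ (i - 1))"
proof (cases "i = 1")
  case True
  then show ?thesis using assms by (auto simp: arc_coeff_eq)
next
  case False
  then have "Av (m + 1) i \<in> set (all_vars n \<mu>)" using assms by (auto simp: set_all_vars)
  then show ?thesis using assms False
    by (simp add: arc_coeff_eq[of n "Suc m" i] along_tangent_var tangent_def)
qed

text \<open>The derivative of \<open>p(X(t))\<close> under the deformation. Both sides are derivations along the arc
  that agree on the variables.\<close>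

lemma along_tangent_arc:
  assumes "vars_mp p \<subseteq> Xv ` {1..n} \<union> range Bv"
  shows "map_poly (along_tangent v) (arc_subst n \<mu> p) = [:v $ 0:] * pderiv (arc p)
    + monom (of_nat \<mu>) (\<mu> - 1) * (\<Sum>j=1..<n. [:v $ j:] * arc (pdiff (Xv (Suc j)) p))"
proof (rule derivation_along_eq[where V = "Xv ` {1..n} \<union> range Bv" and \<phi> = arc])
  show "derivation_along arc (\<lambda>p. map_poly (along_tangent v) (arc_subst n \<mu> p))"
    unfolding arc_def
    by (rule derivation_along_map_poly[OF derivation_along_tangent arc_subst_hom eval_mp_hom])
      (simp add: derivation_along_const[OF derivation_along_tangent])
  have "derivation_along arc (\<lambda>p. pderiv (arc p))"
    by (rule derivation_alongI)
      (simp_all add: arc.hom_add arc.hom_mult pderiv_add pderiv_mult pderiv_pCons algebra_simps)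
  then show "derivation_along arc (\<lambda>p. [:v $ 0:] * pderiv (arc p)
    + monom (of_nat \<mu>) (\<mu> - 1) * (\<Sum>j=1..<n. [:v $ j:] * arc (pdiff (Xv (Suc j)) p)))"
    by (rule derivation_along_plus[OF derivation_along_scale derivation_along_scale[OF derivation_along_sum]])
      (rule derivation_along_scale[OF derivation_along_hom[OF derivation_pdiff arc.comm_ring_hom_axioms]])
  show "map_poly (along_tangent v) (arc_subst n \<mu> (var_mp w)) = [:v $ 0:] * pderiv (arc (var_mp w))
    + monom (of_nat \<mu>) (\<mu> - 1) * (\<Sum>j=1..<n. [:v $ j:] * arc (pdiff (Xv (Suc j)) (var_mp w)))"
    if w: "w \<in> Xv ` {1..n} \<union> range Bv" for w
  proof (cases w)
    case (Bv \<nu>)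
    then show ?thesis
      by (simp add: along_tangent_var tangent_def pdiff_var pderiv_pCons)
  next
    case (Xv i)
    then have i: "i \<in> {1..n}" using w by auto
    have "(\<Sum>j=1..<n. [:v $ j:] * arc (pdiff (Xv (Suc j)) (var_mp w))) = (\<Sum>j=1..<n. if j = i - 1 then [:v $ j:] else 0)"
      using i by (intro sum.cong) (auto simp: Xv pdiff_var)
    also have "\<dots> = (if i = 1 then 0 else [:v $ (i - 1):])" using i by auto
    finally have S: "(\<Sum>j=1..<n. [:v $ j:] * arc (pdiff (Xv (Suc j)) (var_mp w))) = (if i = 1 then 0 else [:v $ (i - 1):])" .
    have "coeff (map_poly (along_tangent v) (arc_subst n \<mu> (var_mp w))) m
        = v $ 0 * (of_nat (m + 1) * coeff (arc (var_mp w)) (m + 1))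
          + (if m = \<mu> - 1 \<and> i \<noteq> 1 then of_nat \<mu> * v $ (i - 1) else 0)" for m
    proof -
      have T: "coeff (arc_subst n \<mu> (var_mp (Xv i) :: 'a mpoly)) m
          = (if m = 0 then var_mp (Xv i) else if m < \<mu> then arc_coeff n (m + 1) i else 0)" for m
        by (cases m) (simp_all add: arc_subst_Xv coeff_sum)
      have base: "along_tangent v (var_mp (Xv i)) = v $ 0 * E (arc_coeff n 2 i)"
        using i by (simp add: along_tangent_var set_all_vars tangent_def image_iff)
      consider "m = 0" | "m \<in> {1..<\<mu>}" "m + 1 < \<mu>" | "m \<in> {1..<\<mu>}" "m + 1 = \<mu>" | "m \<ge> \<mu>"
        by fastforce
      then have "along_tangent v (coeff (arc_subst n \<mu> (var_mp (Xv i))) m)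
        = v $ 0 * (of_nat (m + 1) * coeff (arc (var_mp (Xv i))) (m + 1))
          + (if m = \<mu> - 1 \<and> i \<noteq> 1 then of_nat \<mu> * v $ (i - 1) else 0)"
      proof cases
        case 1
        then show ?thesis using \<mu> base by (simp add: T coeff_arc_Xv numeral_2_eq_2)
      next
        case 2
        then show ?thesis using along_tangent_arc_coeff[OF i, of m v] by (auto simp: T coeff_arc_Xv algebra_simps)
      next
        case 3
        then show ?thesis using along_tangent_arc_coeff[OF i, of m v] by (auto simp: T coeff_arc_Xv)
      next
        case 4
        then show ?thesis using \<mu> by (auto simp: T coeff_arc_Xv)
      qed
      then show ?thesis by (simp only: Xv coeff_map_poly_derivation[OF derivation_along_tangent])
    qed
    then show ?thesis
      unfolding S by (intro poly_eqI) (auto simp: coeff_pderiv coeff_monom_mult coeff_pCons split: nat.split)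
  next
    case (Av k i)
    then show ?thesis using w by auto
  qed
qed (rule assms)

text \<open>Below \<open>t\<^bsup>\<mu>-1\<^esup>\<close> the derivative of \<open>F\<^sub>0(X(t))\<close> has the coefficients of \<open>v\<^sub>1 (F\<^sub>0(X(t)))'\<close>, which
  vanish; at \<open>t\<^bsup>\<mu>-1\<^esup>\<close> it is \<open>\<mu>\<close> times an entry of \<open>contact_mat *\<^sub>v v\<close>.\<close>

lemma along_tangent_G:
  assumes v: "v \<in> carrier_vec n" "contact_mat *\<^sub>v v = 0\<^sub>v n" and r: "r < \<mu> * n"
  shows "along_tangent v (G n \<mu> F $ r) = 0"
proof -
  define i m where "i = r mod n" and "m = r div n"
  have i: "i < n" and m: "m < \<mu>" and r_eq: "r = m * n + i"
    using n r by (auto simp: i_def m_def less_mult_imp_div_less)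
  let ?S = "\<Sum>j=1..<n. [:v $ j:] * arc (pdiff (Xv (Suc j)) (H i))"
  have "along_tangent v (G n \<mu> F $ r) = v $ 0 * (of_nat (m + 1) * coeff (arc (H i)) (m + 1))
      + (if m < \<mu> - 1 then 0 else of_nat \<mu> * coeff ?S (m - (\<mu> - 1)))"
    unfolding r_eq G_entry[OF n F(1) i m] coeff_map_poly_derivation[OF derivation_along_tangent, symmetric]
      along_tangent_arc[OF H_vars[OF i]]
    by (simp add: coeff_pderiv coeff_monom_mult)
  also have "\<dots> = 0"
  proof (cases "m < \<mu> - 1")
    case True
    then show ?thesis using arc_H_low[OF i, of "m + 1"] by simp
  next
    case False
    then have m_eq: "m = \<mu> - 1" using m by simp
    have "0 = (contact_mat *\<^sub>v v) $ i" using v i by simp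
    also have "\<dots> = (\<Sum>j<n. contact_mat $$ (i, j) * v $ j)"
      using v(1) i by (simp add: contact_mat_def scalar_prod_def atLeast0LessThan)
    also have "{..<n} = insert 0 {1..<n}" using n by auto
    also have "(\<Sum>j\<in>insert 0 {1..<n}. contact_mat $$ (i, j) * v $ j)
        = coeff (arc (H i)) \<mu> * v $ 0 + (\<Sum>j=1..<n. E (pdiff (Xv (Suc j)) (H i)) * v $ j)"
      using i n by (simp add: contact_mat_def)
    also have "(\<Sum>j=1..<n. E (pdiff (Xv (Suc j)) (H i)) * v $ j) = coeff ?S 0"
      by (simp add: coeff_sum arc_at_0 mult.commute)
    finally have "v $ 0 * coeff (arc (H i)) \<mu> + coeff ?S 0 = 0" by (simp add: mult.commute)
    then have "of_nat \<mu> * (v $ 0 * coeff (arc (H i)) \<mu> + coeff ?S 0) = 0" by simp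
    then show ?thesis using \<mu> by (simp add: m_eq algebra_simps)
  qed
  finally show ?thesis .
qed

text \<open>A kernel vector \<open>v\<close> of the contact matrix gives a kernel vector of \<open>J\<^sub>G\<close>. It determines \<open>v\<close>:
  its component at \<open>x\<^sub>1\<close> is \<open>v\<^sub>1\<close>, and those at \<open>a\<^bsub>\<mu>,j\<^esub>\<close> are \<open>\<mu> v\<^sub>j\<close>.\<close>

lemma det_contact_mat:
  assumes inv: "invertible_mat (jacobian_at (full_point x b a) (all_vars n \<mu>) (G n \<mu> F))"
  shows "det contact_mat \<noteq> 0"
proof
  let ?vs = "all_vars n \<mu>"
  let ?J = "jacobian_at (full_point x b a) ?vs (G n \<mu> F)"
  have A: "contact_mat \<in> carrier_mat n n" by (simp add: contact_mat_def)
  assume "det contact_mat = 0"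
  then obtain v where v: "v \<in> carrier_vec n" "v \<noteq> 0\<^sub>v n" "contact_mat *\<^sub>v v = 0\<^sub>v n"
    using det_0_iff_vec_prod_zero_field[OF A] by blast
  have dims: "dim_row ?J = \<mu> * n" "dim_col ?J = length ?vs"
    by (simp_all add: jacobian_at_def jacobian_def G_def)
  then have len: "length ?vs = \<mu> * n" using inv by (simp add: invertible_mat_def)
  define d where "d = vec (\<mu> * n) (\<lambda>l. tangent v (?vs ! l))"
  have J: "?J \<in> carrier_mat (\<mu> * n) (\<mu> * n)" using dims len by auto
  have "?J *\<^sub>v d = 0\<^sub>v (\<mu> * n)"
  proof (rule eq_vecI)
    fix r assume "r < dim_vec (0\<^sub>v (\<mu> * n))"
    then have r: "r < \<mu> * n" by simp
    have "(?J *\<^sub>v d) $ r = (\<Sum>l<length ?vs. E (pdiff (?vs ! l) (G n \<mu> F $ r)) * tangent v (?vs ! l))"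
      using r len J by (simp add: scalar_prod_def d_def atLeast0LessThan jacobian_at_def jacobian_def G_def)
    also have "\<dots> = along_tangent v (G n \<mu> F $ r)"
      unfolding along_tangent_def
      using sum.reindex_bij_betw[OF bij_betw_nth[OF distinct_all_vars refl refl], of "\<lambda>w. tangent v w * E (pdiff w (G n \<mu> F $ r))" n \<mu>]
      by (simp add: mult.commute)
    also have "\<dots> = 0" by (rule along_tangent_G[OF v(1,3) r])
    finally show "(?J *\<^sub>v d) $ r = 0\<^sub>v (\<mu> * n) $ r" using r by simp
  qed (use dims in simp)
  moreover obtain B where "inverts_mat ?J B" "inverts_mat B ?J" using inv unfolding invertible_mat_def by blast
  then have BJ: "B * ?J = 1\<^sub>m (\<mu> * n)" and B: "B \<in> carrier_mat (\<mu> * n) (\<mu> * n)"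
  proof -
    have "dim_col B = \<mu> * n"
      using arg_cong[OF \<open>inverts_mat ?J B\<close>[unfolded inverts_mat_def], of dim_col] dims by simp
    moreover have "dim_row B = \<mu> * n"
      using arg_cong[OF \<open>inverts_mat B ?J\<close>[unfolded inverts_mat_def], of dim_col] dims len by simp
    ultimately show "B * ?J = 1\<^sub>m (\<mu> * n)" "B \<in> carrier_mat (\<mu> * n) (\<mu> * n)"
      using \<open>inverts_mat B ?J\<close> unfolding inverts_mat_def by auto
  qed
  ultimately have "1\<^sub>m (\<mu> * n) *\<^sub>v d = B *\<^sub>v 0\<^sub>v (\<mu> * n)"
    using assoc_mult_mat_vec[OF B J, of d] by (simp add: d_def BJ)
  moreover have "B *\<^sub>v 0\<^sub>v (\<mu> * n) = 0\<^sub>v (\<mu> * n)"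
    by (rule eq_vecI) (use B in \<open>auto simp: scalar_prod_def\<close>)
  ultimately have "d = 0\<^sub>v (\<mu> * n)" by (simp add: d_def)
  then have zero: "tangent v w = 0" if "w \<in> set ?vs" for w
    using that len by (metis d_def in_set_conv_nth index_vec index_zero_vec(1))
  have "v $ 0 = 0" using zero[of "Xv 1"] n by (simp add: set_all_vars tangent_def arc_coeff_eq)
  moreover have "v $ j = 0" if "j \<in> {1..<n}" for j
    using zero[of "Av \<mu> (Suc j)"] that \<mu> by (simp add: set_all_vars tangent_def)
  ultimately have "v $ j = 0" if "j < n" for j using that by (cases j) auto
  then have "v = 0\<^sub>v n" using v(1) by (intro eq_vecI) auto
  then show False using v(2) by contradiction
qed

lemma F0_entry: "i < n \<Longrightarrow> F0 n \<mu> F b $ i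
    = subst_mp (\<lambda>v. case v of Bv \<nu> \<Rightarrow> const_mp (b \<nu>) | _ \<Rightarrow> var_mp v) (H i)"
  using F1_carrier[OF F(1), of \<mu>] by (simp add: F0_def)

lemma F0_carrier: "F0 n \<mu> F b \<in> carrier_vec n"
  using F1_carrier[OF F(1), of \<mu>] by (simp add: F0_def)

text \<open>Fixing the smoothing parameters before or after restriction to the arc, or before or after
  differentiation by \<open>x\<^sub>j\<close>, makes no difference.\<close>

lemma F0_specialization:
  assumes i: "i < n"
  shows "F0 n \<mu> F b $ i \<in> carrier (poly_ring n)"
    and "on_curve (F0 n \<mu> F b $ i) = arc (H i)"
    and "ev (pdiff (Xv j) (F0 n \<mu> F b $ i)) = E (pdiff (Xv j) (H i))"
proof -
  let ?s = "subst_mp (\<lambda>v. case v of Bv \<nu> \<Rightarrow> const_mp (b \<nu>) | _ \<Rightarrow> var_mp v) :: 'a mpoly \<Rightarrow> 'a mpoly"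
  let ?V = "Xv ` {1..n} \<union> range Bv"
  have hom: "comm_ring_hom ?s" by (rule insertion_mp_hom[OF const_mp_hom])
  interpret s: comm_ring_hom ?s by (rule hom)
  have S: "subring_set {p :: 'a mpoly. vars_mp p \<subseteq> set (xvars n)}" by (rule vars_mp_subring)
  have "?s p \<in> {p. vars_mp p \<subseteq> set (xvars n)}" if "vars_mp p \<subseteq> ?V" for p
    using that
  proof (induction p rule: mpoly_induct)
    case (add p q)
    then show ?case unfolding s.hom_add by (intro subring_setD(3)[OF S])
  next
    case (mult p q)
    then show ?case unfolding s.hom_mult by (intro subring_setD(4)[OF S])
  next
    case (var v)
    then show ?case by (auto simp: const_mp_hom xvars_set)
  qed simp
  from this[OF H_vars[OF i]]
  show carrier: "F0 n \<mu> F b $ i \<in> carrier (poly_ring n)" by (simp add: F0_entry[OF i])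
  show "on_curve (F0 n \<mu> F b $ i) = arc (H i)"
    unfolding F0_entry[OF i]
    by (rule ring_hom_eq_on_mpoly[OF comm_ring_hom_comp[OF on.comm_ring_hom_axioms hom] arc.comm_ring_hom_axioms H_vars[OF i]])
      (auto simp: const_mp_hom)
  have "pdiff (Xv j) (?s (H i)) = ?s (pdiff (Xv j) (H i))"
  proof (rule derivation_along_eq[where V = UNIV and \<phi> = ?s and D = "\<lambda>p. pdiff (Xv j) (?s p)"
        and E = "\<lambda>p. ?s (pdiff (Xv j) p)"])
    show "derivation_along ?s (\<lambda>p. pdiff (Xv j) (?s p))"
      by (rule derivation_alongI) (simp_all add: s.hom_add s.hom_mult pdiff_add pdiff_mult)
    show "derivation_along ?s (\<lambda>p. ?s (pdiff (Xv j) p))"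
      by (rule derivation_along_hom[OF derivation_pdiff hom])
    show "pdiff (Xv j) (?s (var_mp v)) = ?s (pdiff (Xv j) (var_mp v))" for v
      by (cases v) (simp_all add: const_mp_hom pdiff_var)
  qed simp
  moreover have "E (?s p) = E p" for p
    by (rule ring_hom_eq_on_mpoly[where V = UNIV, OF comm_ring_hom_comp[OF eval_mp_hom hom] eval_mp_hom])
      (auto simp: const_mp_hom full_point_def split: var.split)
  moreover have "ev q = E q" if "vars_mp q \<subseteq> set (xvars n)" for q
    by (rule ring_hom_eq_on_mpoly[OF eval_mp_hom eval_mp_hom that])
      (auto simp: xvars_set full_point_def)
  ultimately show "ev (pdiff (Xv j) (F0 n \<mu> F b $ i)) = E (pdiff (Xv j) (H i))"
    using vars_mp_pdiff[of "F0 n \<mu> F b $ i" "set (xvars n)" "Xv j"] carrier by (simp add: F0_entry[OF i])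
qed

lemma F0_set: "set\<^sub>v (F0 n \<mu> F b) \<subseteq> carrier (poly_ring n)"
  using F0_carrier F0_specialization(1) by (auto simp: vec_set_def)

lemma isolated_component:
  assumes "det contact_mat \<noteq> 0"
  shows "isolated_primary_component (poly_ring n) (system_ideal n (F0 n \<mu> F b)) (point_ideal n x) (contact_ideal n \<mu>)"
proof (rule contact_ideal_isolated[OF n _ F0_carrier F0_set])
  show "monom 1 \<mu> dvd on_curve (F0 n \<mu> F b $ i)" if "i < n" for i
    using arc_H_low[OF that] by (simp add: F0_specialization(2)[OF that] monom_1_dvd_iff')
  have "mat n n (\<lambda>(i, j). if j = 0 then coeff (on_curve (F0 n \<mu> F b $ i)) \<mu>
      else ev (pdiff (Xv (Suc j)) (F0 n \<mu> F b $ i))) = contact_mat"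
    unfolding contact_mat_def by (rule eq_matI) (auto simp: F0_specialization)
  then show "det (mat n n (\<lambda>(i, j). if j = 0 then coeff (on_curve (F0 n \<mu> F b $ i)) \<mu>
      else ev (pdiff (Xv (Suc j)) (F0 n \<mu> F b $ i)))) \<noteq> 0"
    using assms by simp
qed (use \<mu> in simp)

text \<open>The vector \<open>a\<^sub>2\<close> is in the kernel because \<open>F\<^sub>2\<close> vanishes, and all columns except the first are
  columns of the contact matrix.\<close>

lemma corank_F0:
  assumes "det contact_mat \<noteq> 0"
  shows "corank n (jacobian_at (x_point x) (xvars n) (F0 n \<mu> F b)) = 1"
proof -
  let ?J = "jacobian_at (x_point x) (xvars n) (F0 n \<mu> F b)"
  have J: "?J \<in> carrier_mat n n"
    using carrier_vecD[OF F0_carrier] by (intro carrier_matI) (simp_all add: jacobian_at_def jacobian_def xvars_def)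
  have J_entry: "?J $$ (i, j) = E (pdiff (Xv (Suc j)) (H i))" if "i < n" "j < n" for i j
  proof -
    have "xvars n ! j = Xv (Suc j)" "length (xvars n) = n"
      using that(2) by (simp_all add: xvars_def del: upt_Suc)
    then show ?thesis
      using that carrier_vecD[OF F0_carrier] F0_specialization(3)[OF that(1)]
      by (simp add: jacobian_at_def jacobian_def)
  qed
  define w where "w = vec n (\<lambda>j. E (arc_coeff n 2 (Suc j)))"
  have "?J *\<^sub>v w = 0\<^sub>v n"
  proof (rule eq_vecI)
    fix i assume "i < dim_vec (0\<^sub>v n)"
    then have i: "i < n" by simp
    have "(?J *\<^sub>v w) $ i = (\<Sum>j<n. E (pdiff (Xv (Suc j)) (H i)) * E (arc_coeff n 2 (Suc j)))"
      using i J J_entry by (simp add: w_def scalar_prod_def atLeast0LessThan)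
    also have "\<dots> = (\<Sum>j=1..n. E (arc_coeff n 2 j) * E (pdiff (Xv j) (H i)))"
      by (rule sum.reindex_bij_witness[of _ "\<lambda>j. j - 1" Suc]) (auto simp: mult.commute)
    also have "\<dots> = E (arc_deriv n 2 (H i))"
      by (simp add: arc_deriv_def E.hom_sum E.hom_mult)
    also have "arc_deriv n 2 (H i) = coeff (arc_subst n \<mu> (H i)) 1"
      using arc_coeff_recursion[of 1 \<mu> n "H i"] \<mu> arc_subst_at_0[of n \<mu> "H i"]
      by (simp add: poly_0_coeff_0 numeral_2_eq_2)
    also have "E \<dots> = 0" using arc_H_low[OF i, of 1] \<mu> by (simp add: coeff_arc)
    finally show "(?J *\<^sub>v w) $ i = 0\<^sub>v n $ i" using i by simp
  qed (use J in simp)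
  moreover have "w \<noteq> 0\<^sub>v n"
  proof
    assume "w = 0\<^sub>v n"
    then have "w $ 0 = 0" using n by simp
    then show False using n by (simp add: w_def arc_coeff_eq)
  qed
  moreover have "w \<in> carrier_vec n" by (simp add: w_def)
  ultimately have "det ?J = 0" using det_0_iff_vec_prod_zero_field[OF J] by blast
  moreover have "contact_mat \<in> carrier_mat n n" by (simp add: contact_mat_def)
  moreover have "col ?J j = col contact_mat j" if "1 \<le> j" "j < n" for j
    using that J J_entry by (intro eq_vecI) (auto simp: contact_mat_def)
  ultimately show ?thesis using assms by (intro corank_eq_1I[OF n J])
qed

end

theorem theorem4p3:
  fixes F :: "'a::field_char_0 mpoly vec"
    and n \<mu> :: nat
    and x b :: "nat \<Rightarrow> 'a" and a :: "nat \<Rightarrow> nat \<Rightarrow> 'a"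
  assumes "n \<ge> 1" and "\<mu> \<ge> 2"
    and "F \<in> carrier_vec n" and "set\<^sub>v F \<subseteq> carrier (poly_ring n)"
    and "map_vec (eval_mp (full_point x b a)) (G n \<mu> F) = 0\<^sub>v (\<mu> * n)"
    and "corank n (jacobian_at (x_point x) (xvars n) F) = 1"
    and "first_row_dependent (jacobian_at (x_point x) (xvars n) F)"
    and "first_col_dependent (jacobian_at (x_point x) (xvars n) F)"
    and "invertible_mat (jacobian_at (full_point x b a) (all_vars n \<mu>) (G n \<mu> F))"
  shows "isolated_root n (F0 n \<mu> F b) x \<and>
         has_multiplicity n (F0 n \<mu> F b) x \<mu> \<and>
         corank n (jacobian_at (x_point x) (xvars n) (F0 n \<mu> F b)) = 1"
proof -
  interpret deflation_zero F n \<mu> x b a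
    using assms(1-5) by unfold_locales
  have det: "det contact_mat \<noteq> 0" by (rule det_contact_mat[OF assms(9)])
  have zero: "eval_mp (x_point x) p = 0" if p: "p \<in> set\<^sub>v (F0 n \<mu> F b)" for p
  proof -
    obtain i where i: "i < n" "p = F0 n \<mu> F b $ i"
      using p F0_carrier by (auto simp: vec_set_def)
    then show ?thesis
      using on_curve_at_0[of p] F0_specialization(2)[OF i(1)] arc_H_low[OF i(1), of 0] assms(2)
      by (simp add: poly_0_coeff_0)
  qed
  note component = isolated_component[OF det]
  have "isolated_root n (F0 n \<mu> F b) x"
    using zero component unfolding isolated_root_def by blast
  moreover have "has_multiplicity n (F0 n \<mu> F b) x \<mu>"
    using component contact_ideal_codimension[OF assms(1)] unfolding has_multiplicity_def by blast
  ultimately show ?thesis using corank_F0[OF det] by blast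
qed

end
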